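(* Conditionally on $\boldsymbol m$, for every vertex-labelled multigraph $G$ on the vertex set $[n]$, $$\mathbb{P}_m\big(\mathrm{PA}^{(A)}_n(\boldsymbol m,\delta)= G\big)=\mathbb{P}_m\big(\mathrm{CPU}^{(\mathrm{SL})}_n(\boldsymbol m,\boldsymbol\psi)= G\big),$$ where equality with $G$ means equality as vertex-labelled multigraphs, $\mathrm{PA}^{(A)}_n(\boldsymbol m,\delta)$ is preferential attachment model (A), and $\mathrm{CPU}^{(\mathrm{SL})}_n(\boldsymbol m,\boldsymbol\psi)$ is the collapsed Pólya urn graph with self-loops.
   Context: $\mathbb{N}=\{1,2,\dots\}$. $M$ is an $\mathbb{N}$-valued random variable with $\mathbb E[M^p]<\infty$ for some $p>1$, and $\delta>-\inf\operatorname{supp}(M)$. $(m_i)_{i\ge3}$ are i.i.d. copies of $M$, $m_1=m_2=1$, $\boldsymbol m=(m_1,m_2,\dots)$, $m_{[l]}=\sum_{i\le l}m_i$, and $\mathbb P_m$ is the conditional law given $\boldsymbol m$. $G_0$ is a fixed initial multigraph on $\{1,2\}$ with degrees $a_1,a_2$ with $a_i+\delta>0$, and $a_{[2]}=a_1+a_2$. A self-loop contributes $2$ to the degree. **Model (A).** Starting from $G_0$, vertices $v=3,4,\dots,n$ arrive successively, vertex $v$ with $m_v$ edges attached one at a time. If $d_u(v,j-1)$ is the degree of $u$ after the first $j-1$ edges of $v$ have been attached, then the $j$-th edge of $v$ attaches to $u$ with conditional probability $\frac{d_u(v,j-1)+\delta}{c_{v,j}}$ for $u<v$ and $\frac{d_v(v,j-1)+1+\frac{j}{m_v}\delta}{c_{v,j}}$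 for $u=v$, where $c_{v,j}=a_{[2]}+2(m_{[v-1]}+j-2)-1+(v-1)\delta+\frac{j}{m_v}\delta$. **Collapsed Pólya urn graph with self-loops.** Given $\boldsymbol m$, let $\psi_1=1$, $\psi_2\sim\mathrm{Beta}(a_2+\delta,a_1+\delta)$ and, for $k\ge3$ and $l\in[m_k]$, $$\psi_{m_{[k-1]}+l}\sim\mathrm{Beta}\Big(1+\tfrac{\delta}{m_k},\ a_{[2]}+2(m_{[k-1]}+l-3)+(k-1)\delta+\tfrac{l-1}{m_k}\delta\Big),$$ all conditionally independent. Let $N=m_{[n]}$, $\mathcal S_0=0$, $\mathcal S_s=\prod_{i=s+1}^{N}(1-\psi_i)$ for $1\le s\le N$ (so $\mathcal S_N=1$), and $\mathcal I_s=[\mathcal S_{s-1},\mathcal S_s)$. Let $(U_s)$ be i.i.d. uniform on $[0,1]$, independent of $\boldsymbol\psi$. The graph $\mathrm{PU}^{(\mathrm{SL})}_{N}(\boldsymbol 1,\boldsymbol\psi)$ on $[N]$ consists of $G_0$ on $\{1,2\}$ together with exactly one edge from each $s\in\{3,\dots,N\}$, which attaches to the $u\in[s]$ for which $U_s\mathcal S_s\in\mathcal I_u$. The graph $\mathrm{CPU}^{(\mathrm{SL})}_n(\boldsymbol m,\boldsymbol\psi)$ on $[n]$ is obtained by collapsing, for each $k\in[n]$, the group $\{m_{[k-1]}+1,\dots,m_{[k]}\}$ into a single vertex $k$. Edges within a group become self-loops and edges between groups become edges between the corresponding vertices (with multiplicity). *)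

theory Defs
  imports "HOL-Probability.Probability" "HOL-Library.Uprod"
begin

subsection \<open>Vertex-labelled multigraphs\<close>

text \<open>
  A multigraph with labelled vertices is the multiset of its edges, an edge being an unordered pair
  of vertices (\<open>Upair u u\<close> is a self-loop at \<open>u\<close>). The vertex set \<open>[n]\<close> is kept explicit in
  \<open>mgraph_on\<close>. Edges carry no labels and no orientation, so equality of multisets is equality
  as vertex-labelled multigraphs.
\<close>

type_synonym mgraph = "nat uprod multiset"

definition mgraph_on :: "nat \<Rightarrow> mgraph \<Rightarrow> bool" where
  "mgraph_on n G \<longleftrightarrow> (\<forall>e\<in>#G. set_uprod e \<subseteq> {1..n})"

text \<open>A self-loop satisfies both filters, hence contributes \<open>2\<close>.\<close>

definition mg_degree :: "mgraph \<Rightarrow> nat \<Rightarrow> nat" where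
  "mg_degree G u = size {#e \<in># G. u \<in> set_uprod e#} + size {#e \<in># G. e = Upair u u#}"

text \<open>\<open>m\<^sub>[\<^sub>l\<^sub>]\<close>; sequences are indexed from \<open>1\<close>, their value at \<open>0\<close> is never used.\<close>

definition partial_sum :: "(nat \<Rightarrow> nat) \<Rightarrow> nat \<Rightarrow> nat" where
  "partial_sum m l = (\<Sum>i=1..l. m i)"

subsection \<open>Preferential attachment, model (A), for a realised sequence of out-degrees\<close>

definition norm_A :: "mgraph \<Rightarrow> (nat \<Rightarrow> nat) \<Rightarrow> real \<Rightarrow> nat \<Rightarrow> nat \<Rightarrow> real" where
  "norm_A G0 m \<delta> v j =
     real (mg_degree G0 1 + mg_degree G0 2) + 2 * (real (partial_sum m (v - 1)) + real j - 2) - 1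
     + (real v - 1) * \<delta> + real j / real (m v) * \<delta>"

text \<open>
  Law of the endpoint of the \<open>j\<close>-th edge of \<open>v\<close>, where \<open>g\<close> is the graph after the first \<open>j - 1\<close>
  edges of \<open>v\<close> have been attached. The weights form a probability vector for every \<open>g\<close> that occurs
  with positive probability when \<open>m\<^sub>i \<ge> 1\<close>, \<open>\<delta> > - m\<^sub>i\<close> for \<open>i \<ge> 3\<close>, and \<open>a\<^sub>i + \<delta> > 0\<close> for \<open>i = 1, 2\<close>;
  \<open>embed_pmf\<close> is meaningful only in that case.
\<close>

definition attach_pmf :: "mgraph \<Rightarrow> (nat \<Rightarrow> nat) \<Rightarrow> real \<Rightarrow> nat \<Rightarrow> nat \<Rightarrow> mgraph \<Rightarrow> nat pmf" where
  "attach_pmf G0 m \<delta> v j g = embed_pmf (\<lambda>u.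
     if 1 \<le> u \<and> u < v then (real (mg_degree g u) + \<delta>) / norm_A G0 m \<delta> v j
     else if u = v then (real (mg_degree g v) + 1 + real j / real (m v) * \<delta>) / norm_A G0 m \<delta> v j
     else 0)"

primrec attach_edges :: "mgraph \<Rightarrow> (nat \<Rightarrow> nat) \<Rightarrow> real \<Rightarrow> nat \<Rightarrow> nat \<Rightarrow> mgraph \<Rightarrow> mgraph pmf" where
  "attach_edges G0 m \<delta> v 0 g = return_pmf g"
| "attach_edges G0 m \<delta> v (Suc j) g =
     bind_pmf (attach_edges G0 m \<delta> v j g)
       (\<lambda>g'. map_pmf (\<lambda>u. add_mset (Upair v u) g') (attach_pmf G0 m \<delta> v (Suc j) g'))"

primrec PA_A_law :: "mgraph \<Rightarrow> (nat \<Rightarrow> nat) \<Rightarrow> real \<Rightarrow> nat \<Rightarrow> mgraph pmf" where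
  "PA_A_law G0 m \<delta> 0 = return_pmf G0"
| "PA_A_law G0 m \<delta> (Suc n) =
     (if Suc n \<le> 2 then return_pmf G0
      else bind_pmf (PA_A_law G0 m \<delta> n) (attach_edges G0 m \<delta> (Suc n) (m (Suc n))))"

subsection \<open>Collapsed Polya urn graph with self-loops\<close>

definition beta_measure :: "real \<Rightarrow> real \<Rightarrow> real measure" where
  "beta_measure a b = density lborel
     (\<lambda>x. ennreal (if 0 < x \<and> x < 1 then x powr (a - 1) * (1 - x) powr (b - 1) / Beta a b else 0))"

text \<open>The index \<open>k\<close> of the group \<open>{m\<^sub>[\<^sub>k\<^sub>-\<^sub>1\<^sub>] + 1, \<dots>, m\<^sub>[\<^sub>k\<^sub>]}\<close> containing \<open>s\<close>.\<close>

definition group_of :: "(nat \<Rightarrow> nat) \<Rightarrow> nat \<Rightarrow> nat" where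
  "group_of m s = (THE k. 1 \<le> k \<and> s \<in> {partial_sum m (k - 1) + 1..partial_sum m k})"

text \<open>
  Law of \<open>\<psi>\<^sub>s\<close> given \<open>m\<close>; for \<open>s \<ge> 3\<close> one writes \<open>s = m\<^sub>[\<^sub>k\<^sub>-\<^sub>1\<^sub>] + l\<close>.
\<close>

definition psi_law :: "mgraph \<Rightarrow> (nat \<Rightarrow> nat) \<Rightarrow> real \<Rightarrow> nat \<Rightarrow> real measure" where
  "psi_law G0 m \<delta> s =
     (let a1 = real (mg_degree G0 1); a2 = real (mg_degree G0 2) in
      if s = 1 then return borel 1
      else if s = 2 then beta_measure (a2 + \<delta>) (a1 + \<delta>)
      else let k = group_of m s; l = s - partial_sum m (k - 1) in
        beta_measure (1 + \<delta> / real (m k))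
          (a1 + a2 + 2 * (real (partial_sum m (k - 1)) + real l - 3)
           + (real k - 1) * \<delta> + (real l - 1) / real (m k) * \<delta>))"

text \<open>
  Joint law, given \<open>m\<close>, of \<open>(\<psi>\<^sub>s)\<^sub>s\<^sub>\<ge>\<^sub>1\<close> (independent) and \<open>(U\<^sub>s)\<^sub>s\<^sub>\<ge>\<^sub>1\<close> (i.i.d. uniform, independent of \<open>\<psi>\<close>).
\<close>

definition psi_U_law :: "mgraph \<Rightarrow> (nat \<Rightarrow> nat) \<Rightarrow> real \<Rightarrow> ((nat \<Rightarrow> real) \<times> (nat \<Rightarrow> real)) measure" where
  "psi_U_law G0 m \<delta> =
     (\<Pi>\<^sub>M s\<in>{1..}. psi_law G0 m \<delta> s) \<Otimes>\<^sub>M (\<Pi>\<^sub>M s\<in>{1..}. uniform_measure lborel {0..1})"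

definition S_pos :: "nat \<Rightarrow> (nat \<Rightarrow> real) \<Rightarrow> nat \<Rightarrow> real" where
  "S_pos N \<psi> s = (if s = 0 then 0 else (\<Prod>i=s+1..N. 1 - \<psi> i))"

definition I_int :: "nat \<Rightarrow> (nat \<Rightarrow> real) \<Rightarrow> nat \<Rightarrow> real set" where
  "I_int N \<psi> s = {S_pos N \<psi> (s - 1)..<S_pos N \<psi> s}"

text \<open>
  Almost surely there is exactly one \<open>u\<close> as below, and the value of \<open>THE\<close> elsewhere is irrelevant.
\<close>

definition PU_SL :: "mgraph \<Rightarrow> nat \<Rightarrow> (nat \<Rightarrow> real) \<Rightarrow> (nat \<Rightarrow> real) \<Rightarrow> mgraph" where
  "PU_SL G0 N \<psi> U =
     G0 + {#Upair s (THE u. u \<in> {1..s} \<and> U s * S_pos N \<psi> s \<in> I_int N \<psi> u). s \<in># mset_set {3..N}#}"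

definition CPU_SL :: "mgraph \<Rightarrow> nat \<Rightarrow> (nat \<Rightarrow> nat) \<Rightarrow> (nat \<Rightarrow> real) \<Rightarrow> (nat \<Rightarrow> real) \<Rightarrow> mgraph" where
  "CPU_SL G0 n m \<psi> U = image_mset (map_uprod (group_of m)) (PU_SL G0 (partial_sum m n) \<psi> U)"

subsection \<open>Conditioning on the sequence of out-degrees\<close>

text \<open>The sub-\<open>\<sigma>\<close>-algebra generated by \<open>(m\<^sub>i)\<^sub>i\<^sub>\<ge>\<^sub>1\<close>.\<close>

definition sigma_m :: "'w measure \<Rightarrow> ('w \<Rightarrow> nat \<Rightarrow> nat) \<Rightarrow> 'w measure" where
  "sigma_m P m = vimage_algebra (space P) (\<lambda>w. restrict (m w) {1..}) (\<Pi>\<^sub>M i\<in>{1..}. count_space UNIV)"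

text \<open>A version of \<open>P(E | F)\<close>.\<close>

definition cprob :: "'w measure \<Rightarrow> 'w measure \<Rightarrow> 'w set \<Rightarrow> 'w \<Rightarrow> real" where
  "cprob P F E = real_cond_exp P F (indicator E)"

text \<open>\<open>X\<close> is an \<open>N\<close>-valued random variable on \<open>P\<close> whose conditional law given \<open>F\<close> is \<open>K\<close>.\<close>

definition has_cond_law ::
    "'w measure \<Rightarrow> 'w measure \<Rightarrow> 'b measure \<Rightarrow> ('w \<Rightarrow> 'b) \<Rightarrow> ('w \<Rightarrow> 'b measure) \<Rightarrow> bool" where
  "has_cond_law P F N X K \<longleftrightarrow>
     X \<in> P \<rightarrow>\<^sub>M N \<and>
     (\<forall>A\<in>sets N. AE w in P. cprob P F {w \<in> space P. X w \<in> A} w = measure (K w) A)"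

end

(*
  Both graphs are images of one and the same random sequence of targets t(3), t(4), ..., where t(s)
  is the vertex of the uncollapsed graph to which the single edge of s attaches. Vertex i carries an
  initial weight alpha(i), and alpha(i) + #{r. t(r) = i} is its current weight.

  Preferential attachment: choose t(s) in {1..s} with probability proportional to the current
  weight. Summing the weights over a group gives exactly the attachment weights of model (A).

  Polya urn: given psi, the probability of a target sequence is the product over i of
  psi(i)^p(i) * (1 - psi(i))^q(i), where p(i) counts the edges attached to i and q(i) the edges that
  pass i (t(r) < i <= r). Integrating the beta variables gives a product of quotients of beta
  functions. The parameters are such that beta(i) + q(i) is the current total weight of the vertices
  below i; hence appending one more target changes the product by a telescoping factor which is
  precisely the preferential attachment probability.
*)

theory Submission
  imports Defs
begin

section \<open>Target sequences of the uncollapsed urn\<close>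

text \<open>Two obstacles shape the proof. The targets in the urn graph are defined by
  \<open>THE\<close>, which is meaningful only off a null set; the proof therefore works with lower
  bounds for the probability of each target list and recovers equality from total mass one.
  Secondly, the collapse map itself depends on m, so the event that the collapsed graph equals G
  does not say that (\<psi>, U) lies in one fixed set, which is the form a conditional law can
  evaluate. But the dependence on m passes through finitely many integers only. Hence the event
  splits into countably many pieces, on each of which these integers are frozen. The weights arise
  from sharing \<delta> equally inside each group. When the j-th edge of v is attached, exactly j
  members of its group are present, and they carry j shares \<delta>/m_v: this is the origin of the
  term (j/m_v) \<delta> in model (A).\<close>

text \<open>
  A target sequence is a list \<open>t\<close> whose entry \<open>t ! r\<close> is the target of vertex \<open>r + 3\<close>. In \<open>urn_beta\<close>
  the truncated subtraction is intended: there are \<open>i - 3\<close> edges before vertex \<open>i\<close> if \<open>i \<ge> 3\<close>,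
  and none if \<open>i = 2\<close>.
\<close>

definition urn_beta :: "(nat \<Rightarrow> real) \<Rightarrow> nat \<Rightarrow> real" where
  "urn_beta \<alpha> i = (\<Sum>j\<in>{1..<i}. \<alpha> j) + real (i - 3)"

definition urn_weight :: "(nat \<Rightarrow> real) \<Rightarrow> nat list \<Rightarrow> nat \<Rightarrow> real" where
  "urn_weight \<alpha> t i = (\<Sum>j\<in>{1..i}. \<alpha> j + real (count_list t j))"

definition urn_targets :: "nat list \<Rightarrow> bool" where
  "urn_targets t \<longleftrightarrow> (\<forall>r<length t. t ! r \<in> {1..r + 3})"

definition crossings :: "nat list \<Rightarrow> nat \<Rightarrow> nat" where
  "crossings t i = card {r. r < length t \<and> t ! r < i \<and> i \<le> r + 3}"

definition urn_kernel :: "(nat \<Rightarrow> real) \<Rightarrow> nat list \<Rightarrow> nat pmf" where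
  "urn_kernel \<alpha> t = embed_pmf (\<lambda>u. if u \<in> {1..length t + 3}
     then (\<alpha> u + real (count_list t u)) / urn_weight \<alpha> t (length t + 3) else 0)"

primrec urn_pmf :: "(nat \<Rightarrow> real) \<Rightarrow> nat \<Rightarrow> nat list pmf" where
  "urn_pmf \<alpha> 0 = return_pmf []"
| "urn_pmf \<alpha> (Suc k) =
     bind_pmf (urn_pmf \<alpha> k) (\<lambda>t. map_pmf (\<lambda>u. t @ [u]) (urn_kernel \<alpha> t))"

lemma urn_targets_Nil [simp]: "urn_targets []"
  by (simp add: urn_targets_def)

lemma urn_targets_snoc: "urn_targets (t @ [u]) \<longleftrightarrow> urn_targets t \<and> u \<in> {1..length t + 3}"
  by (auto simp: urn_targets_def nth_append less_Suc_eq)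

lemma urn_targets_set: "urn_targets t \<Longrightarrow> set t \<subseteq> {1..length t + 2}"
  by (fastforce simp: urn_targets_def in_set_conv_nth)

lemma crossings_snoc:
  "crossings (t @ [u]) i = crossings t i + (if u < i \<and> i \<le> length t + 3 then 1 else 0)"
proof -
  have eq: "{r. r < length (t @ [u]) \<and> (t @ [u]) ! r < i \<and> i \<le> r + 3} =
      {r. r < length t \<and> t ! r < i \<and> i \<le> r + 3} \<union> (if u < i \<and> i \<le> length t + 3 then {length t} else {})"
    by (auto simp: nth_append less_Suc_eq)
  have fin: "finite {r. r < length t \<and> t ! r < i \<and> i \<le> r + 3}"
    by simp
  show ?thesis
    unfolding crossings_def eq by (subst card_Un_disjoint) (use fin in auto)
qed

lemma crossings_eq_0: "length t + 3 \<le> i \<Longrightarrow> crossings t i = 0"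
  by (auto simp: crossings_def)

lemma crossings_1: "urn_targets t \<Longrightarrow> crossings t (Suc 0) = 0"
  by (force simp: crossings_def urn_targets_def card_eq_0_iff)

text \<open>The edge of vertex s never points above s, and the last vertex with an edge is
  \<open>length t + 2\<close>. From that index on, every edge has its target inside the range and
  adds one.\<close>

lemma urn_weight_full:
  assumes "urn_targets t" "length t + 2 \<le> i"
  shows "urn_weight \<alpha> t i = (\<Sum>j\<in>{1..i}. \<alpha> j) + real (length t)"
proof -
  have "set t \<subseteq> {1..i}"
    using urn_targets_set[OF assms(1)] assms(2) by fastforce
  then have "(\<Sum>j\<in>{1..i}. count_list t j) = length t"
    by (intro sum_count_set) auto
  then show ?thesis
    by (simp add: urn_weight_def sum.distrib flip: of_nat_sum)
qed

lemma urn_weight_snoc: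
  "urn_weight \<alpha> (t @ [u]) i = urn_weight \<alpha> t i + (if u \<in> {1..i} then 1 else 0)"
proof -
  have "urn_weight \<alpha> (t @ [u]) i = urn_weight \<alpha> t i + (\<Sum>j\<in>{1..i}. if j = u then 1 else 0)"
    unfolding urn_weight_def sum.distrib[symmetric] by (intro sum.cong) auto
  then show ?thesis by (simp add: sum.delta)
qed

text \<open>For i \<ge> 3, \<open>urn_beta\<close> is the weight below i just before i chooses its
  target: the i - 3 earlier edges all point below i. From the edge of i on, an edge adds to the
  weight below i exactly when it crosses i.\<close>

lemma urn_beta_crossings:
  assumes "urn_targets t" "i \<in> {2..length t + 3}"
  shows "urn_beta \<alpha> i + real (crossings t i) = urn_weight \<alpha> t (i - 1)"
  using assms
proof (induction t rule: rev_induct)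
  case Nil
  then have "i = 2 \<or> i = 3" by auto
  then show ?case
    by (auto simp: urn_beta_def urn_weight_def crossings_def atLeastLessThanSuc_atLeastAtMost
        numeral_eq_Suc simp del: sum.cl_ivl_Suc)
next
  case (snoc u t)
  show ?case
  proof (cases "i = length (t @ [u]) + 3")
    case True
    \<comment> \<open>Here i is the vertex whose edge comes next: nothing has crossed it, and all
      edges so far point below it.\<close>
    have "{1..<i} = {1..i - 1}" using True by auto
    then show ?thesis
      using True urn_weight_full[OF snoc.prems(1), of "i - 1" \<alpha>]
        crossings_eq_0[of "t @ [u]" i]
      by (simp add: urn_beta_def)
  next
    case False
    then have i: "i \<in> {2..length t + 3}" using snoc.prems by auto
    have u: "urn_targets t" "1 \<le> u" using snoc.prems by (auto simp: urn_targets_snoc)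
    have "(u < i \<and> i \<le> length t + 3) \<longleftrightarrow> u \<in> {1..i - 1}" using i u by auto
    then show ?thesis
      using snoc.IH[OF u(1) i] by (simp add: crossings_snoc urn_weight_snoc)
  qed
qed

lemma urn_weight_pos:
  assumes "\<forall>j\<ge>1. \<alpha> j > 0" "1 \<le> i"
  shows "urn_weight \<alpha> t i > 0"
  unfolding urn_weight_def
  by (intro sum_pos add_pos_nonneg) (use assms in auto)

lemma urn_beta_pos:
  assumes "\<forall>j\<ge>1. \<alpha> j > 0" "2 \<le> i"
  shows "urn_beta \<alpha> i > 0"
  unfolding urn_beta_def
  by (intro add_pos_nonneg sum_pos) (use assms in auto)

lemma pmf_urn_kernel:
  assumes \<alpha>: "\<forall>j\<ge>1. \<alpha> j > 0"
  shows "pmf (urn_kernel \<alpha> t) u = (if u \<in> {1..length t + 3}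
     then (\<alpha> u + real (count_list t u)) / urn_weight \<alpha> t (length t + 3) else 0)"
  unfolding urn_kernel_def
proof (rule pmf_embed_pmf)
  let ?W = "urn_weight \<alpha> t (length t + 3)"
  let ?f = "\<lambda>u. if u \<in> {1..length t + 3} then (\<alpha> u + real (count_list t u)) / ?W else 0"
  have W: "?W > 0" by (rule urn_weight_pos) (use \<alpha> in auto)
  show nn: "0 \<le> ?f u" for u
    using W \<alpha> by (auto intro!: divide_nonneg_pos add_nonneg_nonneg)
  have "(\<integral>\<^sup>+u. ennreal (?f u) \<partial>count_space UNIV) = (\<Sum>u\<in>{1..length t + 3}. ennreal (?f u))"
    by (rule nn_integral_count_space') auto
  also have "\<dots> = ennreal (\<Sum>u\<in>{1..length t + 3}. ?f u)"
    by (rule sum_ennreal) (rule nn)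
  also have "(\<Sum>u\<in>{1..length t + 3}. ?f u) = ?W / ?W"
    by (subst (2) urn_weight_def) (simp add: sum_divide_distrib)
  finally show "(\<integral>\<^sup>+u. ennreal (?f u) \<partial>count_space UNIV) = 1"
    using W by simp
qed

lemma set_urn_kernel:
  assumes "\<forall>j\<ge>1. \<alpha> j > 0"
  shows "set_pmf (urn_kernel \<alpha> t) \<subseteq> {1..length t + 3}"
  using pmf_urn_kernel[OF assms, of t] by (auto simp: set_pmf_iff split: if_splits)

lemma set_urn_pmf:
  assumes \<alpha>: "\<forall>j\<ge>1. \<alpha> j > 0"
  shows "t \<in> set_pmf (urn_pmf \<alpha> k) \<Longrightarrow> length t = k \<and> urn_targets t"
proof (induction k arbitrary: t)
  case (Suc k)
  then obtain t' u where "t' \<in> set_pmf (urn_pmf \<alpha> k)" "u \<in> set_pmf (urn_kernel \<alpha> t')" "t = t' @ [u]"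
    by auto
  with Suc.IH[of t'] set_urn_kernel[OF \<alpha>, of t'] show ?case
    by (auto simp: urn_targets_snoc)
qed simp

text \<open>A list determines its prefix, so a single term of the mixture survives.\<close>

lemma pmf_urn_pmf_snoc:
  "pmf (urn_pmf \<alpha> (Suc k)) (t @ [u]) = pmf (urn_pmf \<alpha> k) t * pmf (urn_kernel \<alpha> t) u"
proof -
  have "pmf (map_pmf (\<lambda>u. t' @ [u]) (urn_kernel \<alpha> t')) (t @ [u]) =
      indicator {t} t' * pmf (urn_kernel \<alpha> t) u" for t'
  proof (cases "t' = t")
    case True
    have "(\<lambda>u. t @ [u]) -` {t @ [u]} = {u}" by auto
    then show ?thesis using True by (simp add: pmf_map measure_pmf_single)
  next
    case False
    then have "(\<lambda>u. t' @ [u]) -` {t @ [u]} = {}" by auto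
    then show ?thesis using False by (simp add: pmf_map)
  qed
  then show ?thesis
    by (simp add: pmf_bind measure_pmf_single)
qed

section \<open>Beta quotients and the probability of a target list\<close>

text \<open>Sampling u with probability proportional to x can be done by descending from s: at i,
  stop with probability x i / W i, otherwise go on with probability W (i - 1) / W i. The factors
  telescope. Vertex 1 has no factor, as a descent that reaches it stops there.\<close>

lemma telescoping_urn_prod:
  fixes x :: "nat \<Rightarrow> real"
  assumes x: "\<forall>j\<ge>1. x j > 0" and us: "1 \<le> u" "u \<le> s"
  defines "W \<equiv> \<lambda>i. \<Sum>j\<in>{1..i}. x j"
  shows "(\<Prod>i\<in>{2..s}. if i = u then x i / W i else if u < i then W (i - 1) / W i else 1) = x u / W s"
  using us(2)
proof (induction s rule: dec_induct)
  case base
  have "(\<Prod>i\<in>{2..u}. if i = u then x i / W i else if u < i then W (i - 1) / W i else 1) =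
      (\<Prod>i\<in>{2..u}. if i = u then x i / W i else 1)"
    by (intro prod.cong) auto
  also have "\<dots> = (if u \<in> {2..u} then x u / W u else 1)"
    by (simp add: prod.delta)
  \<comment> \<open>For u = 1 the range of the product is empty, and x 1 / W 1 = 1.\<close>
  also have "\<dots> = x u / W u"
    using us(1) x by (auto simp: W_def not_le less_Suc_eq numeral_2_eq_2)
  finally show ?case .
next
  case (step s)
  have W: "W s > 0" unfolding W_def using step us x by (intro sum_pos) auto
  have "{2..Suc s} = insert (Suc s) {2..s}" using step us by auto
  then show ?case using step W by simp
qed

lemma Beta_plus1_left_pos: "0 < a \<Longrightarrow> 0 < b \<Longrightarrow> Beta (a + 1) b = a / (a + b) * Beta a (b :: real)"
  using Beta_plus1_left[of a b] nonpos_Ints_nonpos[of a] by (auto simp: field_simps)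

lemma Beta_plus1_right_pos: "0 < a \<Longrightarrow> 0 < b \<Longrightarrow> Beta a (b + 1) = b / (a + b) * Beta a (b :: real)"
  using Beta_plus1_right[of b a] nonpos_Ints_nonpos[of b] by (auto simp: field_simps)

lemma Beta_pos: "0 < a \<Longrightarrow> 0 < b \<Longrightarrow> Beta a (b :: real) > 0"
  by (simp add: Beta_def Gamma_real_pos)

text \<open>Appending u raises the first beta parameter of u by one and the second one of each i
  with u < i \<le> s. The recurrences of the beta function turn this into the stop and pass factors
  of \<open>telescoping_urn_prod\<close>, because \<open>urn_beta_crossings\<close> identifies the
  second parameter with the weight below i.\<close>

lemma pmf_urn_pmf:
  assumes \<alpha>: "\<forall>j\<ge>1. \<alpha> j > 0"
  shows "urn_targets t \<Longrightarrow> pmf (urn_pmf \<alpha> (length t)) t =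
    (\<Prod>i\<in>{2..length t + 2}. Beta (\<alpha> i + real (count_list t i)) (urn_beta \<alpha> i + real (crossings t i))
       / Beta (\<alpha> i) (urn_beta \<alpha> i))"
proof (induction t rule: rev_induct)
  case Nil
  have "Beta (\<alpha> 2) (urn_beta \<alpha> 2) \<noteq> 0"
    using Beta_pos[of "\<alpha> 2", OF _ urn_beta_pos[OF \<alpha>, of 2]] \<alpha> by auto
  then show ?case
    by (simp add: crossings_def numeral_2_eq_2)
next
  case (snoc u t)
  then have t: "urn_targets t" and u: "1 \<le> u" "u \<le> length t + 3"
    by (auto simp: urn_targets_snoc)
  let ?s = "length t + 3"
  let ?x = "\<lambda>j. \<alpha> j + real (count_list t j)"
  let ?W = "urn_weight \<alpha> t"
  let ?B = "\<lambda>t i. Beta (\<alpha> i + real (count_list t i)) (urn_beta \<alpha> i + real (crossings t i))"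
  let ?D = "\<lambda>i. Beta (\<alpha> i) (urn_beta \<alpha> i)"
  have x_pos: "?x j > 0" if "1 \<le> j" for j
    using \<alpha> that by (intro add_pos_nonneg) auto
  have B0: "?D i > 0" if "2 \<le> i" for i
    using Beta_pos[of "\<alpha> i", OF _ urn_beta_pos[OF \<alpha> that]] \<alpha> that by auto
  have step: "?B (t @ [u]) i =
      (if i = u then ?x i / ?W i else if u < i then ?W (i - 1) / ?W i else 1) * ?B t i"
    if "i \<in> {2..?s}" for i
  proof -
    have b: "urn_beta \<alpha> i + real (crossings t i) = ?W (i - 1)"
      by (rule urn_beta_crossings[OF t that])
    have W: "?W i = ?x i + ?W (i - 1)"
      unfolding urn_weight_def using that by (cases i) auto
    have pos: "?x i > 0" "?W (i - 1) > 0"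
      using that x_pos \<alpha> by (auto intro!: urn_weight_pos)
    show ?thesis
    proof (cases "i = u")
      case True
      have "?B (t @ [u]) i = Beta (?x i + 1) (?W (i - 1))"
        using True b by (simp add: crossings_snoc algebra_simps)
      also have "\<dots> = ?x i / ?W i * Beta (?x i) (?W (i - 1))"
        using Beta_plus1_left_pos[OF pos] by (simp add: W)
      finally show ?thesis using True b by simp
    next
      case False
      show ?thesis
      proof (cases "u < i")
        case True
        have "?B (t @ [u]) i = Beta (?x i) (?W (i - 1) + 1)"
          using True False b that by (simp add: crossings_snoc algebra_simps)
        also have "\<dots> = ?W (i - 1) / ?W i * Beta (?x i) (?W (i - 1))"
          using Beta_plus1_right_pos[OF pos] by (simp add: W)
        finally show ?thesis using True False b by simp
      qed (use False in \<open>simp add: crossings_snoc\<close>)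
    qed
  qed
  have "(\<Prod>i\<in>{2..?s}. ?B (t @ [u]) i / ?D i) =
      (\<Prod>i\<in>{2..?s}. (if i = u then ?x i / ?W i else if u < i then ?W (i - 1) / ?W i else 1) * (?B t i / ?D i))"
    by (intro prod.cong refl) (simp only: step times_divide_eq_right)
  also have "\<dots> = (?x u / ?W ?s) * (\<Prod>i\<in>{2..?s}. ?B t i / ?D i)"
    unfolding prod.distrib urn_weight_def
    by (subst telescoping_urn_prod[of ?x u ?s]) (use x_pos u in auto)
  also have "(\<Prod>i\<in>{2..?s}. ?B t i / ?D i) = (\<Prod>i\<in>{2..length t + 2}. ?B t i / ?D i)"
  proof -
    \<comment> \<open>The new vertex has been neither hit nor crossed by the edges of t, so its
      quotient is 1.\<close>
    have "{2..?s} = insert ?s {2..length t + 2}" by auto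
    moreover have "?s \<notin> set t" using urn_targets_set[OF t] by auto
    then have "?B t ?s / ?D ?s = 1"
      using B0[of ?s] by (simp add: crossings_eq_0 count_list_0_iff)
    ultimately show ?thesis by simp
  qed
  also have "\<dots> = pmf (urn_pmf \<alpha> (length t)) t"
    by (rule snoc.IH[OF t, symmetric])
  also have "?x u / ?W ?s = pmf (urn_kernel \<alpha> t) u"
    using u by (simp add: pmf_urn_kernel[OF \<alpha>])
  finally have "(\<Prod>i\<in>{2..?s}. ?B (t @ [u]) i / ?D i) = pmf (urn_pmf \<alpha> (Suc (length t))) (t @ [u])"
    by (simp only: pmf_urn_pmf_snoc mult.commute)
  moreover have "length (t @ [u]) + 2 = ?s" by simp
  ultimately show ?case by (simp only: length_append_singleton)
qed

section \<open>The law of the targets in the Polya urn graph\<close>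

text \<open>Index 0 also receives the point mass, so that every index carries a probability measure,
  as the locale for infinite products demands.\<close>

definition urn_psi :: "(nat \<Rightarrow> real) \<Rightarrow> nat \<Rightarrow> real measure" where
  "urn_psi \<alpha> s = (if s \<le> 1 then return borel 1 else beta_measure (\<alpha> s) (urn_beta \<alpha> s))"

definition urn_law :: "(nat \<Rightarrow> real) \<Rightarrow> ((nat \<Rightarrow> real) \<times> (nat \<Rightarrow> real)) measure" where
  "urn_law \<alpha> = (\<Pi>\<^sub>M s\<in>{1..}. urn_psi \<alpha> s) \<Otimes>\<^sub>M (\<Pi>\<^sub>M s\<in>{1..}. uniform_measure lborel {0..1})"

definition target :: "nat \<Rightarrow> (nat \<Rightarrow> real) \<Rightarrow> (nat \<Rightarrow> real) \<Rightarrow> nat \<Rightarrow> nat" where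
  "target N \<psi> U s = (THE u. u \<in> {1..s} \<and> U s * S_pos N \<psi> s \<in> I_int N \<psi> u)"

definition targets :: "nat \<Rightarrow> (nat \<Rightarrow> real) \<Rightarrow> (nat \<Rightarrow> real) \<Rightarrow> nat list" where
  "targets N \<psi> U = map (\<lambda>r. target N \<psi> U (r + 3)) [0..<N - 2]"

section \<open>Beta and uniform laws\<close>

lemma sets_beta_measure [simp, measurable_cong]: "sets (beta_measure a b) = sets borel"
  by (simp add: beta_measure_def)

lemma space_beta_measure [simp]: "space (beta_measure a b) = UNIV"
  by (simp add: beta_measure_def)

text \<open>The factor x^p (1 - x)^q turns the density into an unnormalised beta density with
  parameters a + p and b + q.\<close>

lemma nn_integral_beta_measure:
  assumes ab: "0 < a" "0 < b"
  shows "(\<integral>\<^sup>+x. ennreal (x ^ p * (1 - x) ^ q) \<partial>beta_measure a b) =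
    ennreal (Beta (a + real p) (b + real q) / Beta a b)"
proof -
  let ?d = "\<lambda>x. if 0 < x \<and> x < 1 then x powr (a - 1) * (1 - x) powr (b - 1) / Beta a b else 0"
  let ?h = "\<lambda>x. x powr (a + real p - 1) * (1 - x) powr (b + real q - 1) / Beta a b"
  have B: "Beta a b > 0" by (rule Beta_pos[OF ab])
  have eq: "ennreal (?d x) * ennreal (x ^ p * (1 - x) ^ q) = ennreal (if x \<in> {0..1} then ?h x else 0)" for x
  proof (cases "0 < x \<and> x < 1")
    case True
    then have "x powr (a + real p - 1) = x powr (a - 1) * x ^ p"
      "(1 - x) powr (b + real q - 1) = (1 - x) powr (b - 1) * (1 - x) ^ q"
      by (simp_all add: powr_add[symmetric] powr_realpow[symmetric] algebra_simps)
    then show ?thesis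
      using True B by (simp add: ennreal_mult[symmetric])
  next
    case False
    \<comment> \<open>The density is cut off to the open interval, \<open>?h\<close> to the closed
      one; they agree at the end points since \<open>0 powr y = 0\<close>.\<close>
    then have "x = 0 \<or> x = 1 \<or> x \<notin> {0..1}" by auto
    then show ?thesis by auto
  qed
  have "(\<integral>\<^sup>+x. ennreal (x ^ p * (1 - x) ^ q) \<partial>beta_measure a b) =
      (\<integral>\<^sup>+x. ennreal (if x \<in> {0..1} then ?h x else 0) \<partial>lborel)"
    unfolding beta_measure_def by (subst nn_integral_density) (auto simp only: eq intro: , measurable)
  also have "\<dots> = ennreal (Beta (a + real p) (b + real q) / Beta a b)"
  proof (rule nn_integral_has_integral_lborel)
    show "((\<lambda>x. if x \<in> {0..1} then ?h x else 0) has_integral Beta (a + real p) (b + real q) / Beta a b) UNIV"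
      unfolding has_integral_restrict_UNIV
      using has_integral_divide[OF has_integral_Beta_real[of "a + real p" "b + real q"], of "Beta a b"] ab
      by simp
  qed (use B in auto)
  finally show ?thesis .
qed

lemma prob_space_beta_measure:
  assumes "0 < a" "0 < b"
  shows "prob_space (beta_measure a b)"
proof
  show "emeasure (beta_measure a b) (space (beta_measure a b)) = 1"
    using nn_integral_beta_measure[OF assms, of 0 0] Beta_pos[OF assms] by simp
qed

lemma AE_beta_measure: "AE x in beta_measure a b. 0 < x \<and> x < 1"
  unfolding beta_measure_def by (subst AE_density) (auto split: if_splits)

lemma sets_urn_psi [simp, measurable_cong]: "sets (urn_psi \<alpha> s) = sets borel"
  by (simp add: urn_psi_def)

lemma space_urn_psi [simp]: "space (urn_psi \<alpha> s) = UNIV"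
  by (simp add: urn_psi_def)

lemma prob_space_urn_psi:
  assumes "\<forall>j\<ge>1. \<alpha> j > 0"
  shows "prob_space (urn_psi \<alpha> s)"
  using assms urn_beta_pos[OF assms, of s]
  by (auto simp: urn_psi_def intro!: prob_space_return prob_space_beta_measure)

lemma AE_urn_psi: "AE x in urn_psi \<alpha> s. (s \<le> 1 \<longrightarrow> x = 1) \<and> (s > 1 \<longrightarrow> 0 < x \<and> x < 1)"
proof (cases "s \<le> 1")
  case True
  then have eq: "urn_psi \<alpha> s = return borel 1" by (simp add: urn_psi_def)
  have "AE x in return borel (1 :: real). x = 1" by (subst AE_return) auto
  then show ?thesis unfolding eq by eventually_elim (use True in auto)
next
  case False
  then have eq: "urn_psi \<alpha> s = beta_measure (\<alpha> s) (urn_beta \<alpha> s)" by (simp add: urn_psi_def)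
  show ?thesis unfolding eq using AE_beta_measure by eventually_elim (use False in auto)
qed

text \<open>At s = 1 the variable is constantly 1, so 1 - x vanishes and the integral is 1 only
  through \<open>0 ^ 0 = 1\<close>; hence the condition on q, which \<open>crossings_1\<close>
  supplies.\<close>

lemma nn_integral_urn_psi:
  assumes \<alpha>: "\<forall>j\<ge>1. \<alpha> j > 0" and "1 \<le> s" and "s = 1 \<Longrightarrow> q = 0"
  shows "(\<integral>\<^sup>+x. ennreal (x ^ p * (1 - x) ^ q) \<partial>urn_psi \<alpha> s) =
    ennreal (if s = 1 then 1 else Beta (\<alpha> s + real p) (urn_beta \<alpha> s + real q) / Beta (\<alpha> s) (urn_beta \<alpha> s))"
proof (cases "s = 1")
  case True
  then show ?thesis
    using assms by (simp add: urn_psi_def nn_integral_return)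
next
  case False
  then show ?thesis
    using assms urn_beta_pos[OF \<alpha>, of s] by (simp add: urn_psi_def nn_integral_beta_measure)
qed

lemma prob_space_uniform01: "prob_space (uniform_measure lborel {0..1 :: real})"
  by (rule prob_space_uniform_measure) auto

lemma emeasure_uniform01:
  fixes c d :: real
  assumes "0 \<le> c" "c \<le> d" "d \<le> 1"
  shows "emeasure (uniform_measure lborel {0..1}) {c..<d} = ennreal (d - c)"
proof -
  have "{0..1} \<inter> {c..<d} = {c..<d}" using assms by auto
  then show ?thesis using assms by (simp add: divide_ennreal_def)
qed

lemma sets_urn_law: "sets (urn_law \<alpha>) = sets ((\<Pi>\<^sub>M s\<in>{1..}. borel) \<Otimes>\<^sub>M (\<Pi>\<^sub>M s\<in>{1..}. borel))"
  unfolding urn_law_def by (intro sets_pair_measure_cong sets_PiM_cong) auto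

section \<open>Measurability of the targets\<close>

lemma measurable_map_list:
  fixes f :: "'i \<Rightarrow> 'a \<Rightarrow> 'b :: countable"
  assumes f: "\<And>r. f r \<in> M \<rightarrow>\<^sub>M count_space UNIV"
  shows "(\<lambda>x. map (\<lambda>r. f r x) rs) \<in> M \<rightarrow>\<^sub>M count_space UNIV"
proof (induction rs)
  case (Cons r rs)
  have "(\<lambda>x. a # map (\<lambda>r. f r x) rs) \<in> M \<rightarrow>\<^sub>M count_space UNIV" for a
    using Cons.IH by (rule measurable_compose) simp
  from measurable_compose_countable[OF this f[of r]] show ?case
    by simp
qed simp

text \<open>\<open>THE\<close> is a function of the set of candidates, and this set takes finitely
  many values. So the result depends measurably on x even where it is a junk value.\<close>

lemma measurable_THE_finite:
  assumes I: "finite I" and P: "\<And>u. Measurable.pred M (P u)"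
  shows "(\<lambda>x. THE u. u \<in> I \<and> P u x) \<in> M \<rightarrow>\<^sub>M count_space UNIV"
proof -
  let ?A = "\<lambda>x. {u \<in> I. P u x}"
  have "?A -` {B} \<inter> space M \<in> sets M" if "B \<subseteq> I" for B
  proof -
    have "?A -` {B} \<inter> space M = {x \<in> space M. \<forall>u\<in>I. P u x \<longleftrightarrow> u \<in> B}"
      using that by auto
    also have "\<dots> \<in> sets M"
      using P by (intro sets.sets_Collect_finite_All I sets.sets_Collect) (auto simp: pred_def)
    finally show ?thesis .
  qed
  moreover have "countable (Pow I)" using I by (intro countable_finite) simp
  ultimately have "?A \<in> M \<rightarrow>\<^sub>M count_space (Pow I)"
    by (subst measurable_count_space_eq_countable) auto
  then have "(\<lambda>x. THE u. u \<in> ?A x) \<in> M \<rightarrow>\<^sub>M count_space UNIV"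
    by (rule measurable_compose) simp
  then show ?thesis by simp
qed

lemma measurable_targets:
  "(\<lambda>x. targets N (fst x) (snd x)) \<in>
     (\<Pi>\<^sub>M s\<in>{1..}. borel) \<Otimes>\<^sub>M (\<Pi>\<^sub>M s\<in>{1..}. borel) \<rightarrow>\<^sub>M count_space UNIV"
proof -
  let ?M = "(\<Pi>\<^sub>M s\<in>{1..}. borel :: real measure) \<Otimes>\<^sub>M (\<Pi>\<^sub>M s\<in>{1..}. borel :: real measure)"
  have psi: "(\<lambda>x. fst x i) \<in> borel_measurable ?M" and U: "(\<lambda>x. snd x i) \<in> borel_measurable ?M"
    if "1 \<le> i" for i
    using that by (auto intro!: measurable_compose[OF measurable_fst measurable_component_singleton]
        measurable_compose[OF measurable_snd measurable_component_singleton])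
  have S [measurable]: "(\<lambda>x. S_pos N (fst x) s) \<in> borel_measurable ?M" for s
    unfolding S_pos_def
    by (cases "s = 0") (auto intro!: borel_measurable_prod borel_measurable_diff psi)
  have tgt: "(\<lambda>x. target N (fst x) (snd x) (r + 3)) \<in> ?M \<rightarrow>\<^sub>M count_space UNIV" for r
    unfolding target_def
  proof (rule measurable_THE_finite)
    have [measurable]: "(\<lambda>x. snd x (r + 3)) \<in> borel_measurable ?M" by (rule U) simp
    show "Measurable.pred ?M (\<lambda>x. snd x (r + 3) * S_pos N (fst x) (r + 3) \<in> I_int N (fst x) u)" for u
      unfolding I_int_def atLeastLessThan_iff by measurable
  qed simp
  show ?thesis
    unfolding targets_def by (rule measurable_map_list) (rule tgt)
qed

text \<open>The integrand reads only the coordinates in J, so the infinite product may be replaced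
  by its finite marginal.\<close>

lemma (in product_prob_space) nn_integral_PiM_prod:
  assumes J: "J \<subseteq> I" "finite J" and f: "\<And>i. i \<in> J \<Longrightarrow> f i \<in> borel_measurable (M i)"
  shows "(\<integral>\<^sup>+x. (\<Prod>i\<in>J. f i (x i)) \<partial>Pi\<^sub>M I M) = (\<Prod>i\<in>J. integral\<^sup>N (M i) (f i))"
proof -
  have meas: "(\<lambda>x. \<Prod>i\<in>J. f i (x i)) \<in> borel_measurable (Pi\<^sub>M J M)"
  proof (rule borel_measurable_prod_ennreal)
    fix i assume i: "i \<in> J"
    have "(\<lambda>x. x i) \<in> Pi\<^sub>M J M \<rightarrow>\<^sub>M M i" using i by (rule measurable_component_singleton)
    then show "(\<lambda>x. f i (x i)) \<in> borel_measurable (Pi\<^sub>M J M)"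
      by (rule measurable_compose) (rule f[OF i])
  qed
  have "(\<Prod>i\<in>J. integral\<^sup>N (M i) (f i)) = (\<integral>\<^sup>+x. (\<Prod>i\<in>J. f i (x i)) \<partial>Pi\<^sub>M J M)"
    by (rule product_nn_integral_prod[symmetric]) (use J f in auto)
  also have "\<dots> = (\<integral>\<^sup>+x. (\<Prod>i\<in>J. f i (x i)) \<partial>distr (Pi\<^sub>M I M) (Pi\<^sub>M J M) (\<lambda>x. restrict x J))"
    by (simp add: distr_PiM_restrict_finite[OF J(2,1)])
  also have "\<dots> = (\<integral>\<^sup>+x. (\<Prod>i\<in>J. f i (x i)) \<partial>Pi\<^sub>M I M)"
    by (subst nn_integral_distr) (use J meas in \<open>auto intro!: measurable_restrict_subset nn_integral_cong prod.cong\<close>)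
  finally show ?thesis ..
qed

section \<open>Stick breaking: the targets for fixed \<psi>\<close>

text \<open>For 1 \<le> u \<le> s this is the ratio
  \<open>S_pos N \<psi> u / S_pos N \<psi> s\<close>, from which N has cancelled. The convention
  that the zeroth position is 0 needs no separate clause here: for u = 0 the product contains the
  factor 1 - \<psi> 1 = 0.\<close>

definition stick :: "(nat \<Rightarrow> real) \<Rightarrow> nat \<Rightarrow> nat \<Rightarrow> real" where
  "stick \<psi> s u = (\<Prod>i\<in>{u + 1..s}. 1 - \<psi> i)"

definition sticks :: "nat \<Rightarrow> (nat \<Rightarrow> real) \<Rightarrow> bool" where
  "sticks N \<psi> \<longleftrightarrow> \<psi> 1 = 1 \<and> (\<forall>i\<in>{2..N}. 0 < \<psi> i \<and> \<psi> i < 1)"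

lemma sticks_bounds: "sticks N \<psi> \<Longrightarrow> 1 \<le> i \<Longrightarrow> i \<le> N \<Longrightarrow> 0 < \<psi> i \<and> \<psi> i \<le> 1"
  by (cases "i = 1") (auto simp: sticks_def intro: less_imp_le)

lemma stick_0: "sticks N \<psi> \<Longrightarrow> 1 \<le> s \<Longrightarrow> stick \<psi> s 0 = 0"
  by (auto simp: stick_def sticks_def intro!: bexI[of _ 1])

lemma stick_nonneg: "sticks N \<psi> \<Longrightarrow> s \<le> N \<Longrightarrow> 0 \<le> stick \<psi> s u"
  unfolding stick_def by (intro prod_nonneg ballI) (use sticks_bounds[of N \<psi>] in fastforce)

lemma stick_le_1: "sticks N \<psi> \<Longrightarrow> s \<le> N \<Longrightarrow> stick \<psi> s u \<le> 1"
  unfolding stick_def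
  by (intro prod_le_1) (use sticks_bounds[of N \<psi>] in \<open>fastforce intro: less_imp_le\<close>)

lemma stick_pred: "1 \<le> u \<Longrightarrow> u \<le> s \<Longrightarrow> stick \<psi> s (u - 1) = (1 - \<psi> u) * stick \<psi> s u"
proof -
  assume "1 \<le> u" "u \<le> s"
  then have "{u - 1 + 1..s} = insert u {u + 1..s}" by auto
  then show ?thesis by (simp add: stick_def)
qed

lemma stick_mono:
  assumes "sticks N \<psi>" "s \<le> N" "u \<le> v" "v \<le> s"
  shows "stick \<psi> s u \<le> stick \<psi> s v"
  using assms(3,4)
proof (induction v rule: dec_induct)
  case (step v)
  have "stick \<psi> s v = (1 - \<psi> (Suc v)) * stick \<psi> s (Suc v)"
    using stick_pred[of "Suc v" s \<psi>] step by simp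
  also have "\<dots> \<le> stick \<psi> s (Suc v)"
    using stick_nonneg[OF assms(1,2)] sticks_bounds[OF assms(1), of "Suc v"] step assms(2)
    by (intro mult_left_le_one_le) auto
  finally show ?case using step by auto
qed simp

lemma S_pos_pos: "sticks N \<psi> \<Longrightarrow> 1 \<le> s \<Longrightarrow> 0 < S_pos N \<psi> s"
  by (auto simp: S_pos_def sticks_def intro!: prod_pos)

lemma S_pos_stick:
  assumes "sticks N \<psi>" "u \<le> s" "1 \<le> s" "s \<le> N"
  shows "S_pos N \<psi> u = stick \<psi> s u * S_pos N \<psi> s"
proof (cases "u = 0")
  case True
  then show ?thesis using stick_0[OF assms(1,3)] by (simp add: S_pos_def)
next
  case False
  have "{u + 1..N} = {u + 1..s} \<union> {s + 1..N}" using assms by auto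
  then have "(\<Prod>i\<in>{u + 1..N}. 1 - \<psi> i) = stick \<psi> s u * (\<Prod>i\<in>{s + 1..N}. 1 - \<psi> i)"
    unfolding stick_def by (subst prod.union_disjoint[symmetric]) auto
  then show ?thesis using False assms by (simp add: S_pos_def)
qed

lemma I_int_stick:
  assumes "sticks N \<psi>" "1 \<le> u" "u \<le> s" "s \<le> N"
  shows "x * S_pos N \<psi> s \<in> I_int N \<psi> u \<longleftrightarrow> x \<in> {stick \<psi> s (u - 1)..<stick \<psi> s u}"
  using assms S_pos_stick[of N \<psi> u s] S_pos_stick[of N \<psi> "u - 1" s] S_pos_pos[of N \<psi> s]
  by (simp add: I_int_def)

lemma target_eqI:
  assumes "sticks N \<psi>" "1 \<le> u" "u \<le> s" "s \<le> N" and U: "U s \<in> {stick \<psi> s (u - 1)..<stick \<psi> s u}"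
  shows "target N \<psi> U s = u"
  unfolding target_def
proof (rule the_equality)
  show "u \<in> {1..s} \<and> U s * S_pos N \<psi> s \<in> I_int N \<psi> u"
    using assms I_int_stick[OF assms(1-4)] by auto
next
  fix v assume v: "v \<in> {1..s} \<and> U s * S_pos N \<psi> s \<in> I_int N \<psi> v"
  then have U': "U s \<in> {stick \<psi> s (v - 1)..<stick \<psi> s v}"
    using I_int_stick[OF assms(1), of v s "U s"] assms by auto
  show "v = u"
  proof (cases v u rule: linorder_cases)
    case less
    then have "stick \<psi> s v \<le> stick \<psi> s (u - 1)" by (intro stick_mono[OF assms(1)]) (use assms in auto)
    then show ?thesis using U U' by auto
  next
    case greater
    then have "stick \<psi> s u \<le> stick \<psi> s (v - 1)" by (intro stick_mono[OF assms(1)]) (use assms v in auto)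
    then show ?thesis using U U' by auto
  qed
qed

text \<open>The same factors, collected by edges on the left and by vertices on the right. The
  interval that an edge from s must hit to reach u has length \<psi> u times the factors 1 - \<psi>
  i of the vertices i that it crosses. The upper end n is free so that it stays fixed while the list
  grows.\<close>

lemma prod_targets:
  fixes \<psi> :: "nat \<Rightarrow> real"
  assumes "urn_targets t" "length t + 2 \<le> n"
  shows "(\<Prod>r<length t. \<psi> (t ! r) * stick \<psi> (r + 3) (t ! r)) =
    (\<Prod>i\<in>{1..n}. \<psi> i ^ count_list t i * (1 - \<psi> i) ^ crossings t i)"
  using assms
proof (induction t rule: rev_induct)
  case Nil
  then show ?case by (simp add: crossings_def)
next
  case (snoc u t)
  then have t: "urn_targets t" and u: "1 \<le> u" "u \<le> length t + 3" and n: "length t + 3 \<le> n"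
    by (auto simp: urn_targets_snoc)
  let ?s = "length t + 3"
  have "(\<Prod>r<length (t @ [u]). \<psi> ((t @ [u]) ! r) * stick \<psi> (r + 3) ((t @ [u]) ! r)) =
      (\<Prod>r<length t. \<psi> (t ! r) * stick \<psi> (r + 3) (t ! r)) * (\<psi> u * stick \<psi> ?s u)"
    by (simp add: nth_append)
  also have "\<psi> u = (\<Prod>i\<in>{1..n}. if i = u then \<psi> i else 1)"
    using u n by (simp add: prod.delta)
  also have "stick \<psi> ?s u = (\<Prod>i\<in>{1..n}. if u < i \<and> i \<le> ?s then 1 - \<psi> i else 1)"
    unfolding stick_def by (rule prod.mono_neutral_cong_left) (use u n in auto)
  also have "(\<Prod>r<length t. \<psi> (t ! r) * stick \<psi> (r + 3) (t ! r)) =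
      (\<Prod>i\<in>{1..n}. \<psi> i ^ count_list t i * (1 - \<psi> i) ^ crossings t i)"
    using snoc t by simp
  also have "(\<Prod>i\<in>{1..n}. \<psi> i ^ count_list t i * (1 - \<psi> i) ^ crossings t i) *
      ((\<Prod>i\<in>{1..n}. if i = u then \<psi> i else 1) * (\<Prod>i\<in>{1..n}. if u < i \<and> i \<le> ?s then 1 - \<psi> i else 1)) =
      (\<Prod>i\<in>{1..n}. \<psi> i ^ count_list (t @ [u]) i * (1 - \<psi> i) ^ crossings (t @ [u]) i)"
    unfolding prod.distrib[symmetric] by (intro prod.cong) (auto simp: crossings_snoc)
  finally show ?case .
qed

text \<open>If each uniform variable falls into the interval of its prescribed target, the list is
  t; by independence this has the product of the interval lengths as probability. Only \<ge> is
  claimed, since a junk value of \<open>THE\<close> might produce an entry of t as well.\<close>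

lemma urn_slice_ge:
  assumes t: "urn_targets t" and psi: "sticks (length t + 2) \<psi>"
  defines "Y \<equiv> \<Pi>\<^sub>M s\<in>{1..}. uniform_measure lborel {0..1 :: real}"
  assumes meas: "{U \<in> space Y. targets (length t + 2) \<psi> U = t} \<in> sets Y"
  shows "(\<Prod>i\<in>{1..length t + 2}. ennreal (\<psi> i ^ count_list t i * (1 - \<psi> i) ^ crossings t i))
    \<le> emeasure Y {U \<in> space Y. targets (length t + 2) \<psi> U = t}"
proof -
  let ?k = "length t" and ?N = "length t + 2"
  interpret U: product_prob_space "\<lambda>_. uniform_measure lborel {0..1 :: real}" "{1 :: nat..}"
    by (intro product_prob_spaceI prob_space_uniform01)
  define X where "X = (\<lambda>s. {stick \<psi> s (t ! (s - 3) - 1)..<stick \<psi> s (t ! (s - 3))})"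
  have tr: "1 \<le> t ! r" "t ! r \<le> r + 3" if "r < ?k" for r
    using t that by (auto simp: urn_targets_def)
  have X: "emeasure (uniform_measure lborel {0..1}) (X (r + 3)) = ennreal (\<psi> (t ! r) * stick \<psi> (r + 3) (t ! r))"
    if "r < ?k" for r
  proof -
    have "emeasure (uniform_measure lborel {0..1}) (X (r + 3)) =
        ennreal (stick \<psi> (r + 3) (t ! r) - stick \<psi> (r + 3) (t ! r - 1))"
      unfolding X_def add_diff_cancel_right'
      using that tr[OF that]
      by (intro emeasure_uniform01 stick_nonneg[OF psi] stick_le_1[OF psi] stick_mono[OF psi]) auto
    also have "stick \<psi> (r + 3) (t ! r) - stick \<psi> (r + 3) (t ! r - 1) = \<psi> (t ! r) * stick \<psi> (r + 3) (t ! r)"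
      unfolding stick_pred[OF tr[OF that]] by (simp add: algebra_simps)
    finally show ?thesis .
  qed
  have nn: "0 \<le> \<psi> i ^ p * (1 - \<psi> i) ^ q" if "i \<in> {1..?N}" for i p q
    using sticks_bounds[OF psi, of i] that by auto
  have nn': "0 \<le> \<psi> (t ! r) * stick \<psi> (r + 3) (t ! r)" if "r < ?k" for r
  proof (rule mult_nonneg_nonneg)
    have "t ! r \<in> {1..?N}" using urn_targets_set[OF t] nth_mem[OF that] by auto
    then show "0 \<le> \<psi> (t ! r)" using sticks_bounds[OF psi, of "t ! r"] by auto
  qed (use stick_nonneg[OF psi, of "r + 3"] that in auto)
  have "(\<Prod>i\<in>{1..?N}. ennreal (\<psi> i ^ count_list t i * (1 - \<psi> i) ^ crossings t i)) =
      ennreal (\<Prod>r<?k. \<psi> (t ! r) * stick \<psi> (r + 3) (t ! r))"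
    unfolding prod_targets[OF t order_refl] by (rule prod_ennreal) (rule nn)
  also have "\<dots> = (\<Prod>r<?k. ennreal (\<psi> (t ! r) * stick \<psi> (r + 3) (t ! r)))"
    by (rule prod_ennreal[symmetric]) (use nn' in auto)
  also have "\<dots> = (\<Prod>r<?k. emeasure (uniform_measure lborel {0..1}) (X (r + 3)))"
    by (intro prod.cong) (use X in auto)
  also have "\<dots> = (\<Prod>s\<in>{3..<?k + 3}. emeasure (uniform_measure lborel {0..1}) (X s))"
    by (rule prod.reindex_bij_witness[of _ "\<lambda>s. s - 3" "\<lambda>r. r + 3"]) auto
  also have "\<dots> = emeasure Y {U \<in> space Y. \<forall>s\<in>{3..<?k + 3}. U s \<in> X s}"
    unfolding Y_def by (rule U.emeasure_PiM_Collect[symmetric]) (auto simp: X_def)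
  also have "\<dots> \<le> emeasure Y {U \<in> space Y. targets ?N \<psi> U = t}"
  proof (intro emeasure_mono meas subsetI)
    fix U assume "U \<in> {U \<in> space Y. \<forall>s\<in>{3..<?k + 3}. U s \<in> X s}"
    then have U: "U \<in> space Y" "\<And>s. s \<in> {3..<?k + 3} \<Longrightarrow> U s \<in> X s" by auto
    have "target ?N \<psi> U (r + 3) = t ! r" if "r < ?k" for r
      by (rule target_eqI[OF psi tr[OF that]]) (use U(2)[of "r + 3"] that in \<open>auto simp: X_def\<close>)
    then have "targets ?N \<psi> U = t"
      by (intro nth_equalityI) (auto simp: targets_def)
    then show "U \<in> {U \<in> space Y. targets ?N \<psi> U = t}" using U by simp
  qed
  finally show ?thesis .
qed

text \<open>Integrating the slice bound over \<psi> factorises by independence into mixed moments of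
  beta variables, whose product is the formula of \<open>pmf_urn_pmf\<close>.\<close>

lemma emeasure_urn_law_ge:
  assumes \<alpha>: "\<forall>j\<ge>1. \<alpha> j > 0" and t: "urn_targets t"
  shows "ennreal (pmf (urn_pmf \<alpha> (length t)) t) \<le>
    emeasure (urn_law \<alpha>) {x \<in> space (urn_law \<alpha>). targets (length t + 2) (fst x) (snd x) = t}"
proof -
  let ?N = "length t + 2"
  define Q where "Q = (\<Pi>\<^sub>M s\<in>{1..}. urn_psi \<alpha> s)"
  define Y where "Y = (\<Pi>\<^sub>M s\<in>{1 :: nat..}. uniform_measure lborel {0..1 :: real})"
  define A where "A = {x \<in> space (urn_law \<alpha>). targets ?N (fst x) (snd x) = t}"
  interpret Q: product_prob_space "urn_psi \<alpha>" "{1..}"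
    by (intro product_prob_spaceI prob_space_urn_psi \<alpha>)
  interpret Y: prob_space Y
    unfolding Y_def by (intro prob_space_PiM prob_space_uniform01)
  have law: "urn_law \<alpha> = Q \<Otimes>\<^sub>M Y" by (simp add: urn_law_def Q_def Y_def)
  have "(\<lambda>x. targets ?N (fst x) (snd x)) \<in> urn_law \<alpha> \<rightarrow>\<^sub>M count_space UNIV"
    using measurable_targets[of ?N] measurable_cong_sets[OF sets_urn_law refl] by blast
  from measurable_sets[OF this, of "{t}"] have "A \<in> sets (urn_law \<alpha>)"
    by (simp add: A_def vimage_def Int_def conj_commute)
  then have A: "A \<in> sets (Q \<Otimes>\<^sub>M Y)" by (simp add: law)
  have slice: "Pair \<psi> -` A = {U \<in> space Y. targets ?N \<psi> U = t}" if "\<psi> \<in> space Q" for \<psi>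
    using that by (auto simp: A_def law space_pair_measure)
  have "AE \<psi> in Q. \<forall>i\<in>{1..?N}. (i \<le> 1 \<longrightarrow> \<psi> i = 1) \<and> (i > 1 \<longrightarrow> 0 < \<psi> i \<and> \<psi> i < 1)"
    unfolding Q_def
  proof (rule AE_finite_allI)
    fix i assume "i \<in> {1..?N}"
    then show "AE \<psi> in Pi\<^sub>M {1..} (urn_psi \<alpha>). (i \<le> 1 \<longrightarrow> \<psi> i = 1) \<and> (i > 1 \<longrightarrow> 0 < \<psi> i \<and> \<psi> i < 1)"
      by (intro AE_PiM_component AE_urn_psi prob_space_urn_psi \<alpha>) auto
  qed simp
  then have sticks: "AE \<psi> in Q. sticks ?N \<psi>"
    by eventually_elim (auto simp: sticks_def)
  \<comment> \<open>Index 1 joins the product with factor 1, to match the integral over the constant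
    \<psi> 1.\<close>
  have "pmf (urn_pmf \<alpha> (length t)) t =
      (\<Prod>i\<in>{1..?N}. if i = 1 then 1 else Beta (\<alpha> i + real (count_list t i)) (urn_beta \<alpha> i + real (crossings t i))
       / Beta (\<alpha> i) (urn_beta \<alpha> i))"
    unfolding pmf_urn_pmf[OF \<alpha> t] by (rule prod.mono_neutral_cong_left) auto
  also have "ennreal \<dots> = (\<Prod>i\<in>{1..?N}. ennreal (if i = 1 then 1 else
      Beta (\<alpha> i + real (count_list t i)) (urn_beta \<alpha> i + real (crossings t i)) / Beta (\<alpha> i) (urn_beta \<alpha> i)))"
    using \<alpha> urn_beta_pos[OF \<alpha>]
    by (intro prod_ennreal[symmetric]) (auto intro!: divide_nonneg_nonneg less_imp_le[OF Beta_pos] add_pos_nonneg)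
  also have "\<dots> = (\<Prod>i\<in>{1..?N}. \<integral>\<^sup>+x. ennreal (x ^ count_list t i * (1 - x) ^ crossings t i) \<partial>urn_psi \<alpha> i)"
    by (intro prod.cong nn_integral_urn_psi[symmetric] \<alpha>) (auto simp: crossings_1[OF t])
  also have "\<dots> = (\<integral>\<^sup>+\<psi>. (\<Prod>i\<in>{1..?N}. ennreal (\<psi> i ^ count_list t i * (1 - \<psi> i) ^ crossings t i)) \<partial>Q)"
    unfolding Q_def by (rule Q.nn_integral_PiM_prod[symmetric]) auto
  also have "\<dots> \<le> (\<integral>\<^sup>+\<psi>. emeasure Y (Pair \<psi> -` A) \<partial>Q)"
  proof (rule nn_integral_mono_AE)
    show "AE \<psi> in Q. (\<Prod>i\<in>{1..?N}. ennreal (\<psi> i ^ count_list t i * (1 - \<psi> i) ^ crossings t i))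
        \<le> emeasure Y (Pair \<psi> -` A)"
      using sticks AE_space
    proof eventually_elim
      case (elim \<psi>)
      show ?case
        unfolding slice[OF elim(2)] unfolding Y_def
      proof (rule urn_slice_ge[OF t elim(1)])
        show "{U \<in> space (\<Pi>\<^sub>M s\<in>{1..}. uniform_measure lborel {0..1}). targets ?N \<psi> U = t}
            \<in> sets (\<Pi>\<^sub>M s\<in>{1..}. uniform_measure lborel {0..1})"
          using sets_Pair1[OF A, of \<psi>] unfolding slice[OF elim(2)] unfolding Y_def .
      qed
    qed
  qed
  also have "\<dots> = emeasure (Q \<Otimes>\<^sub>M Y) A"
    by (rule Y.emeasure_pair_measure_alt[OF A, symmetric])
  finally show ?thesis by (simp add: law A_def)
qed

text \<open>
  An inequality between two probability measures on a countable space is an equality. So almost sure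
  existence of the target need not be shown: a lower bound for each list suffices.
\<close>

lemma prob_space_eq_measure_pmf:
  fixes q :: "'a :: countable pmf"
  assumes "prob_space M" and "sets M = UNIV" and ge: "\<And>x. ennreal (pmf q x) \<le> emeasure M {x}"
  shows "M = measure_pmf q"
proof (rule measure_eqI)
  interpret prob_space M by fact
  show "sets M = sets (measure_pmf q)" using assms(2) by simp
  have le: "emeasure (measure_pmf q) B \<le> emeasure M B" for B
  proof -
    have "emeasure (measure_pmf q) B = (\<integral>\<^sup>+x. emeasure (measure_pmf q) {x} \<partial>count_space B)"
      by (rule emeasure_countable_singleton) auto
    also have "\<dots> \<le> (\<integral>\<^sup>+x. emeasure M {x} \<partial>count_space B)"
      by (intro nn_integral_mono) (use ge in \<open>simp add: emeasure_pmf_single\<close>)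
    also have "\<dots> = emeasure M B"
      by (rule emeasure_countable_singleton[symmetric]) (use assms(2) in auto)
    finally show ?thesis .
  qed
  fix B assume "B \<in> sets M"
  have le': "measure (measure_pmf q) C \<le> prob C" for C
    using le[of C] by (simp add: emeasure_eq_measure measure_pmf.emeasure_eq_measure)
  have "space M = UNIV" using assms(2) sets.top[of M] sets.sets_into_space[of UNIV M] by auto
  then have "prob (- B) = 1 - prob B"
    using prob_compl[of B] assms(2) by (simp add: Compl_eq_Diff_UNIV)
  moreover have "measure (measure_pmf q) (- B) = 1 - measure (measure_pmf q) B"
    using measure_pmf.prob_compl[of B q] by (simp add: Compl_eq_Diff_UNIV)
  \<comment> \<open>The bounds for B and for its complement are opposite inequalities for B.\<close>
  ultimately show "emeasure M B = emeasure (measure_pmf q) B"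
    using le'[of B] le'[of "- B"] by (simp add: emeasure_eq_measure measure_pmf.emeasure_eq_measure)
qed

lemma prob_space_urn_law:
  assumes "\<forall>j\<ge>1. \<alpha> j > 0"
  shows "prob_space (urn_law \<alpha>)"
  unfolding urn_law_def
  by (intro prob_space_pair prob_space_PiM prob_space_uniform01 prob_space_urn_psi assms)

lemma distr_urn_law_targets:
  assumes \<alpha>: "\<forall>j\<ge>1. \<alpha> j > 0" and N: "2 \<le> N"
  shows "distr (urn_law \<alpha>) (count_space UNIV) (\<lambda>x. targets N (fst x) (snd x)) = measure_pmf (urn_pmf \<alpha> (N - 2))"
proof -
  have meas: "(\<lambda>x. targets N (fst x) (snd x)) \<in> urn_law \<alpha> \<rightarrow>\<^sub>M count_space UNIV"
    using measurable_targets[of N] measurable_cong_sets[OF sets_urn_law refl] by blast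
  interpret L: prob_space "urn_law \<alpha>" by (rule prob_space_urn_law[OF \<alpha>])
  interpret D: prob_space "distr (urn_law \<alpha>) (count_space UNIV) (\<lambda>x. targets N (fst x) (snd x))"
    by (rule L.prob_space_distr[OF meas])
  show ?thesis
  proof (rule prob_space_eq_measure_pmf[OF D.prob_space_axioms])
    fix t :: "nat list"
    show "ennreal (pmf (urn_pmf \<alpha> (N - 2)) t) \<le>
        emeasure (distr (urn_law \<alpha>) (count_space UNIV) (\<lambda>x. targets N (fst x) (snd x))) {t}"
    proof (cases "t \<in> set_pmf (urn_pmf \<alpha> (N - 2))")
      case True
      then have "urn_targets t" "N - 2 = length t" "N = length t + 2"
        using set_urn_pmf[OF \<alpha>] N by auto
      then show ?thesis
        using emeasure_urn_law_ge[OF \<alpha>, of t] meas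
        by (simp add: emeasure_distr vimage_def Int_def conj_commute)
    qed (simp add: set_pmf_iff)
  qed simp
qed

section \<open>Collapsing the urn to model (A)\<close>

lemma partial_sum_0 [simp]: "partial_sum m 0 = 0"
  by (simp add: partial_sum_def)

lemma partial_sum_Suc [simp]: "partial_sum m (Suc k) = partial_sum m k + m (Suc k)"
  by (simp add: partial_sum_def)

lemma partial_sum_mono: "k \<le> l \<Longrightarrow> partial_sum m k \<le> partial_sum m l"
  by (induction l rule: dec_induct) auto

lemma group_of_eqI:
  assumes "1 \<le> k" "partial_sum m (k - 1) < s" "s \<le> partial_sum m k"
  shows "group_of m s = k"
  unfolding group_of_def
proof (rule the_equality)
  show "1 \<le> k \<and> s \<in> {partial_sum m (k - 1) + 1..partial_sum m k}" using assms by auto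
next
  fix l assume l: "1 \<le> l \<and> s \<in> {partial_sum m (l - 1) + 1..partial_sum m l}"
  show "l = k"
  proof (cases l k rule: linorder_cases)
    case less
    then have "partial_sum m l \<le> partial_sum m (k - 1)" by (intro partial_sum_mono) auto
    then show ?thesis using l assms by auto
  next
    case greater
    then have "partial_sum m k \<le> partial_sum m (l - 1)" by (intro partial_sum_mono) auto
    then show ?thesis using l assms by auto
  qed
qed

text \<open>The properties shared by almost all realisations of m. The last conjunct makes the
  weight 1 + \<delta> / m_i positive.\<close>

definition valid_degrees :: "(nat \<Rightarrow> nat) \<Rightarrow> real \<Rightarrow> bool" where
  "valid_degrees m \<delta> \<longleftrightarrow> m 1 = 1 \<and> m 2 = 1 \<and> (\<forall>i\<ge>3. 1 \<le> m i \<and> 0 < real (m i) + \<delta>)"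

lemma valid_degrees_ge_1: "valid_degrees m \<delta> \<Longrightarrow> 1 \<le> i \<Longrightarrow> 1 \<le> m i"
  by (cases "i = 1 \<or> i = 2") (auto simp: valid_degrees_def)

lemma partial_sum_2: "valid_degrees m \<delta> \<Longrightarrow> partial_sum m 2 = 2"
  by (simp add: valid_degrees_def numeral_2_eq_2)

lemma le_partial_sum: "valid_degrees m \<delta> \<Longrightarrow> k \<le> partial_sum m k"
proof (induction k)
  case (Suc k)
  then show ?case using valid_degrees_ge_1[of m \<delta> "Suc k"] by simp
qed simp

lemma group_of_cases:
  assumes "valid_degrees m \<delta>" "1 \<le> s"
  obtains k where "1 \<le> k" "partial_sum m (k - 1) < s" "s \<le> partial_sum m k" "group_of m s = k"
proof -
  \<comment> \<open>The partial sums are unbounded because all degrees are at least 1; minimality of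
    k gives the strict lower bound.\<close>
  define k where "k = (LEAST k. s \<le> partial_sum m k)"
  have k: "s \<le> partial_sum m k"
    unfolding k_def using le_partial_sum[OF assms(1)] by (rule LeastI)
  then have "k \<noteq> 0" using assms by (cases k) auto
  then have "partial_sum m (k - 1) < s"
    using not_less_Least[of "k - 1" "\<lambda>k. s \<le> partial_sum m k"] by (auto simp flip: k_def)
  then show thesis
    using that[of k] k \<open>k \<noteq> 0\<close> group_of_eqI[of k m s] by auto
qed

lemma group_of_eq_iff:
  assumes "valid_degrees m \<delta>" "1 \<le> s"
  shows "group_of m s = k \<longleftrightarrow> 1 \<le> k \<and> partial_sum m (k - 1) < s \<and> s \<le> partial_sum m k"
  using group_of_cases[OF assms] group_of_eqI[of k m s] by metis

lemma group_of_1: "valid_degrees m \<delta> \<Longrightarrow> group_of m 1 = 1"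
  by (rule group_of_eqI) (auto simp: valid_degrees_def)

lemma group_of_2: "valid_degrees m \<delta> \<Longrightarrow> group_of m 2 = 2"
  by (rule group_of_eqI) (auto simp: valid_degrees_def numeral_2_eq_2)

text \<open>Vertices 1 and 2 start with their degrees in \<open>G0\<close>. A later urn vertex
  starts with 1 for the source end of its own edge, plus its share of the \<delta> of its
  group.\<close>

definition urn_init :: "mgraph \<Rightarrow> (nat \<Rightarrow> nat) \<Rightarrow> real \<Rightarrow> nat \<Rightarrow> real" where
  "urn_init G0 m \<delta> s = (if s \<le> 2 then real (mg_degree G0 s) + \<delta> else 1 + \<delta> / real (m (group_of m s)))"

text \<open>\<open>\<gamma>\<close> is the collapse map. It acts on the new edges only, so that the
  initial graph can be supplied either as it stands or already collapsed.\<close>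

definition urn_graph :: "mgraph \<Rightarrow> (nat \<Rightarrow> nat) \<Rightarrow> nat list \<Rightarrow> mgraph" where
  "urn_graph G0 \<gamma> t = G0 + mset (map (\<lambda>r. Upair (\<gamma> (r + 3)) (\<gamma> (t ! r))) [0..<length t])"

lemma urn_graph_Nil [simp]: "urn_graph G0 \<gamma> [] = G0"
  by (simp add: urn_graph_def)

lemma urn_graph_snoc:
  "urn_graph G0 \<gamma> (t @ [u]) = add_mset (Upair (\<gamma> (length t + 3)) (\<gamma> u)) (urn_graph G0 \<gamma> t)"
proof -
  have "map (\<lambda>r. Upair (\<gamma> (r + 3)) (\<gamma> ((t @ [u]) ! r))) [0..<length t] =
      map (\<lambda>r. Upair (\<gamma> (r + 3)) (\<gamma> (t ! r))) [0..<length t]"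
    by (intro map_cong refl) (simp add: nth_append)
  moreover have "[0..<length (t @ [u])] = [0..<length t] @ [length t]" by simp
  ultimately show ?thesis unfolding urn_graph_def by (simp only: map_append mset_append) simp
qed

lemma mg_degree_eq_0:
  assumes "mgraph_on n G" "n < v"
  shows "mg_degree G v = 0"
proof -
  have "v \<notin> set_uprod e" if "e \<in># G" for e
    using that assms by (fastforce simp: mgraph_on_def)
  moreover from this have "Upair v v \<notin># G" by fastforce
  ultimately show ?thesis
    by (auto simp: mg_degree_def filter_mset_eq_conv multiset_eq_iff count_eq_zero_iff)
qed

lemma mg_degree_add_mset:
  "mg_degree (add_mset (Upair a b) G) v = mg_degree G v + (if a = v then 1 else 0) + (if b = v then 1 else 0)"
  by (auto simp: mg_degree_def)

text \<open>Source ends and target ends are counted separately; a self-loop thus counts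
  twice.\<close>

lemma mg_degree_urn_graph:
  "mg_degree (urn_graph G0 \<gamma> t) v =
     mg_degree G0 v + card {s \<in> {3..length t + 2}. \<gamma> s = v} + count_list (map \<gamma> t) v"
proof (induction t rule: rev_induct)
  case Nil
  have "{s \<in> {3..2 :: nat}. \<gamma> s = v} = {}" by auto
  then show ?case by (simp only: urn_graph_Nil) (simp add: numeral_2_eq_2)
next
  case (snoc u t)
  have "{3..length (t @ [u]) + 2} = insert (length t + 3) {3..length t + 2}" by auto
  then have "{s \<in> {3..length (t @ [u]) + 2}. \<gamma> s = v} =
      {s \<in> {3..length t + 2}. \<gamma> s = v} \<union> (if \<gamma> (length t + 3) = v then {length t + 3} else {})"
    by auto
  moreover have "card ({s \<in> {3..length t + 2}. \<gamma> s = v} \<union> (if \<gamma> (length t + 3) = v then {length t + 3} else {})) =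
      card {s \<in> {3..length t + 2}. \<gamma> s = v} + (if \<gamma> (length t + 3) = v then 1 else 0)"
    by (subst card_Un_disjoint) auto
  ultimately show ?case
    using snoc.IH by (simp add: urn_graph_snoc mg_degree_add_mset)
qed

lemma sum_count_list_group:
  assumes "set t \<subseteq> A" "finite A"
  shows "(\<Sum>u\<in>{u \<in> A. \<gamma> u = v}. count_list t u) = count_list (map \<gamma> t) v"
  using assms(1)
proof (induction t)
  case (Cons x t)
  have "(\<Sum>u\<in>{u \<in> A. \<gamma> u = v}. count_list (x # t) u) =
      (\<Sum>u\<in>{u \<in> A. \<gamma> u = v}. count_list t u) + (\<Sum>u\<in>{u \<in> A. \<gamma> u = v}. if u = x then 1 else 0)"
    unfolding sum.distrib[symmetric] by (intro sum.cong) auto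
  also have "(\<Sum>u\<in>{u \<in> A. \<gamma> u = v}. if u = x then 1 else 0) = (if \<gamma> x = v then 1 else 0 :: nat)"
    using Cons.prems assms(2) by (subst sum.delta) auto
  finally show ?case using Cons by simp
qed simp

context
  fixes G0 :: mgraph and m :: "nat \<Rightarrow> nat" and \<delta> :: real
  assumes valid: "valid_degrees m \<delta>"
    and a_delta: "\<forall>i\<in>{1, 2}. real (mg_degree G0 i) + \<delta> > 0"
begin

lemma urn_init_pos: "\<forall>s\<ge>1. urn_init G0 m \<delta> s > 0"
proof (intro allI impI)
  fix s :: nat assume s: "1 \<le> s"
  show "urn_init G0 m \<delta> s > 0"
  proof (cases "s \<le> 2")
    case True
    with s have "s = 1 \<or> s = 2" by auto
    then show ?thesis using a_delta by (auto simp: urn_init_def)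
  next
    case False
    obtain k where k: "1 \<le> k" "s \<le> partial_sum m k" "group_of m s = k"
      using group_of_cases[OF valid s] by metis
    have "3 \<le> k"
    proof (rule ccontr)
      assume "\<not> 3 \<le> k"
      then have "partial_sum m k \<le> partial_sum m 2" by (intro partial_sum_mono) auto
      then show False using False k partial_sum_2[OF valid] by auto
    qed
    then have "1 \<le> m k" "0 < real (m k) + \<delta>" using valid by (auto simp: valid_degrees_def)
    then have "0 < 1 + \<delta> / real (m k)" by (simp add: field_simps)
    then show ?thesis using False k by (simp add: urn_init_def)
  qed
qed

lemma urn_init_group:
  assumes "3 \<le> k" "1 \<le> l" "l \<le> m k"
  shows "urn_init G0 m \<delta> (partial_sum m (k - 1) + l) = 1 + \<delta> / real (m k)"
proof -
  have "2 \<le> partial_sum m (k - 1)"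
    using partial_sum_mono[of 2 "k - 1" m] partial_sum_2[OF valid] assms by auto
  moreover have "group_of m (partial_sum m (k - 1) + l) = k"
    using assms by (intro group_of_eqI) (cases k; auto)+
  ultimately show ?thesis using assms by (simp add: urn_init_def)
qed

lemma sum_urn_init_group:
  assumes "3 \<le> k" "l \<le> m k"
  shows "(\<Sum>j\<in>{partial_sum m (k - 1) + 1..partial_sum m (k - 1) + l}. urn_init G0 m \<delta> j)
    = real l + real l / real (m k) * \<delta>"
proof -
  have "(\<Sum>j\<in>{partial_sum m (k - 1) + 1..partial_sum m (k - 1) + l}. urn_init G0 m \<delta> j) =
     (\<Sum>j\<in>{partial_sum m (k - 1) + 1..partial_sum m (k - 1) + l}. 1 + \<delta> / real (m k))"
  proof (intro sum.cong refl)
    fix j assume "j \<in> {partial_sum m (k - 1) + 1..partial_sum m (k - 1) + l}"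
    then show "urn_init G0 m \<delta> j = 1 + \<delta> / real (m k)"
      using urn_init_group[of k "j - partial_sum m (k - 1)"] assms by auto
  qed
  then show ?thesis by (simp add: algebra_simps)
qed

text \<open>Each complete group contributes one full \<delta>. The -2 appears because vertices 1 and
  2 contribute their degrees in place of a 1. Both \<open>norm_A\<close> and the second beta
  parameter of the urn derive from this sum.\<close>

lemma sum_urn_init_upto:
  assumes "3 \<le> k" "l \<le> m k"
  shows "(\<Sum>j\<in>{1..partial_sum m (k - 1) + l}. urn_init G0 m \<delta> j) =
     real (mg_degree G0 1 + mg_degree G0 2) + real (partial_sum m (k - 1) + l) - 2
      + (real k - 1) * \<delta> + real l / real (m k) * \<delta>"
proof -
  have full: "(\<Sum>j\<in>{1..partial_sum m k}. urn_init G0 m \<delta> j) =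
     real (mg_degree G0 1 + mg_degree G0 2) + real (partial_sum m k) - 2 + real k * \<delta>" if "2 \<le> k" for k
    using that
  proof (induction k rule: dec_induct)
    case base
    have "{1..2 :: nat} = {1, 2}" by auto
    then show ?case using partial_sum_2[OF valid] by (simp add: urn_init_def)
  next
    case (step k)
    have "{1..partial_sum m (Suc k)} = {1..partial_sum m k} \<union> {partial_sum m k + 1..partial_sum m k + m (Suc k)}"
      by auto
    then have "(\<Sum>j\<in>{1..partial_sum m (Suc k)}. urn_init G0 m \<delta> j) = (\<Sum>j\<in>{1..partial_sum m k}. urn_init G0 m \<delta> j)
        + (\<Sum>j\<in>{partial_sum m k + 1..partial_sum m k + m (Suc k)}. urn_init G0 m \<delta> j)"
      by (simp only:) (rule sum.union_disjoint; auto)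
    then show ?case
      using sum_urn_init_group[of "Suc k" "m (Suc k)"] step valid_degrees_ge_1[OF valid, of "Suc k"]
      by (simp add: algebra_simps)
  qed
  have "{1..partial_sum m (k - 1) + l} = {1..partial_sum m (k - 1)} \<union> {partial_sum m (k - 1) + 1..partial_sum m (k - 1) + l}"
    by auto
  then have "(\<Sum>j\<in>{1..partial_sum m (k - 1) + l}. urn_init G0 m \<delta> j) = (\<Sum>j\<in>{1..partial_sum m (k - 1)}. urn_init G0 m \<delta> j)
      + (\<Sum>j\<in>{partial_sum m (k - 1) + 1..partial_sum m (k - 1) + l}. urn_init G0 m \<delta> j)"
    by (simp only:) (rule sum.union_disjoint; auto)
  then show ?thesis
    using sum_urn_init_group[OF assms] full[of "k - 1"] assms(1)
    by (simp add: of_nat_diff algebra_simps)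
qed

context
  assumes G0: "mgraph_on 2 G0"
begin

text \<open>Initial weights already include the source end of each edge. In an earlier group all
  these edges are attached, so they count as degree and the shares add up to \<delta>. In the group
  of v the last member s is present, but its edge is still pending: this is the extra 1 in the
  self-loop weight.\<close>

lemma sum_group_urn_init:
  assumes v: "3 \<le> v" "1 \<le> j" "j \<le> m v" and s: "s = partial_sum m (v - 1) + j" and u: "1 \<le> u" "u \<le> v"
  shows "(\<Sum>x\<in>{x \<in> {1..s}. group_of m x = u}. urn_init G0 m \<delta> x) =
    real (mg_degree G0 u + card {x \<in> {3..s - 1}. group_of m x = u})
      + (if u = v then 1 + real j / real (m v) * \<delta> else \<delta>)"
proof -
  have eq: "{x \<in> {1..s}. group_of m x = u} = {x. partial_sum m (u - 1) < x \<and> x \<le> partial_sum m u \<and> x \<le> s}"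
    using group_of_eq_iff[OF valid, of _ u] u by auto
  have s2: "2 \<le> partial_sum m (v - 1)"
    using partial_sum_mono[of 2 "v - 1" m] partial_sum_2[OF valid] v by auto
  consider "u \<le> 2" | "3 \<le> u" "u < v" | "u = v" using u by linarith
  then show ?thesis
  proof cases
    case 1
    have grp: "group_of m x = u \<longleftrightarrow> x = u" if "1 \<le> x" for x
      using group_of_eq_iff[OF valid that, of u] 1 u partial_sum_2[OF valid] valid
      by (cases "u = 1") (auto simp: valid_degrees_def numeral_2_eq_2 le_Suc_eq)
    have "{x \<in> {1..s}. group_of m x = u} = {u}" "{x \<in> {3..s - 1}. group_of m x = u} = {}"
      using grp 1 u s s2 by auto
    then show ?thesis using 1 v by (simp add: urn_init_def)
  next
    case 2
    have le: "partial_sum m u \<le> partial_sum m (v - 1)" "2 \<le> partial_sum m (u - 1)"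
      using 2 partial_sum_mono[of 2 "u - 1" m] partial_sum_2[OF valid] by (auto intro!: partial_sum_mono)
    have ps: "partial_sum m u = partial_sum m (u - 1) + m u" using 2 by (cases u) auto
    have A: "{x \<in> {1..s}. group_of m x = u} = {partial_sum m (u - 1) + 1..partial_sum m (u - 1) + m u}"
      unfolding eq using le s ps by auto
    have "{x \<in> {3..s - 1}. group_of m x = u} = {x \<in> {1..s}. group_of m x = u}"
    proof -
      have "3 \<le> x \<and> x \<le> s - 1" if "x \<in> {1..s}" "group_of m x = u" for x
      proof -
        have "x \<in> {partial_sum m (u - 1) + 1..partial_sum m (u - 1) + m u}" using that A by blast
        then show ?thesis using le s ps v by auto
      qed
      then show ?thesis by auto
    qed
    then have "card {x \<in> {3..s - 1}. group_of m x = u} = m u"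
      unfolding A by simp
    then show ?thesis
      unfolding A using sum_urn_init_group[of u "m u"] 2 mg_degree_eq_0[OF G0, of u]
        valid_degrees_ge_1[OF valid, of u] by simp
  next
    case 3
    have ps: "partial_sum m v = partial_sum m (v - 1) + m v" using v by (cases v) auto
    have A: "{x \<in> {1..s}. group_of m x = u} = {partial_sum m (v - 1) + 1..partial_sum m (v - 1) + j}"
      unfolding eq using 3 s v ps by auto
    have "{x \<in> {3..s - 1}. group_of m x = u} = {x \<in> {1..s}. group_of m x = u} - {s}"
    proof -
      have "3 \<le> x" if "x \<in> {1..s}" "group_of m x = u" for x
      proof -
        have "x \<in> {partial_sum m (v - 1) + 1..partial_sum m (v - 1) + j}" using that A by blast
        then show ?thesis using s2 by auto
      qed
      then show ?thesis by auto
    qed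
    also have "\<dots> = {partial_sum m (v - 1) + 1..<partial_sum m (v - 1) + j}"
      unfolding A using s by auto
    finally have "card {x \<in> {3..s - 1}. group_of m x = u} = j - 1" by simp
    then show ?thesis
      unfolding A using sum_urn_init_group[of v j] 3 v mg_degree_eq_0[OF G0, of v]
      by (simp add: of_nat_diff)
  qed
qed

text \<open>Adding the received edges to \<open>sum_group_urn_init\<close> completes the degree. So
  the collapsed transition depends on t only through the collapsed graph.\<close>

lemma map_urn_kernel:
  assumes t: "urn_targets t" "length t + 3 = partial_sum m (v - 1) + j" and v: "3 \<le> v" "1 \<le> j" "j \<le> m v"
  shows "map_pmf (group_of m) (urn_kernel (urn_init G0 m \<delta>) t) =
    attach_pmf G0 m \<delta> v j (urn_graph G0 (group_of m) t)"
proof -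
  let ?s = "length t + 3" and ?\<gamma> = "group_of m" and ?\<alpha> = "urn_init G0 m \<delta>"
  let ?K = "urn_kernel ?\<alpha> t"
  have W: "urn_weight ?\<alpha> t ?s = norm_A G0 m \<delta> v j"
  proof -
    have "urn_weight ?\<alpha> t ?s = (\<Sum>i\<in>{1..?s}. ?\<alpha> i) + real (length t)"
      by (rule urn_weight_full[OF t(1)]) simp
    also have "real (length t) = real (partial_sum m (v - 1)) + real j - 3"
      using arg_cong[OF t(2), of real] by simp
    finally show ?thesis
      using sum_urn_init_upto[OF v(1,3)] by (simp add: t(2) norm_A_def)
  qed
  have pmf: "pmf (map_pmf ?\<gamma> ?K) u =
      ((\<Sum>x\<in>{x \<in> {1..?s}. ?\<gamma> x = u}. ?\<alpha> x) + real (count_list (map ?\<gamma> t) u)) / norm_A G0 m \<delta> v j" for u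
  proof -
    have "pmf (map_pmf ?\<gamma> ?K) u = measure_pmf.prob ?K {x \<in> {1..?s}. ?\<gamma> x = u}"
      unfolding pmf_map using set_urn_kernel[OF urn_init_pos, of t]
      by (intro measure_pmf.finite_measure_eq_AE) (auto simp: AE_measure_pmf_iff)
    also have "\<dots> = (\<Sum>x\<in>{x \<in> {1..?s}. ?\<gamma> x = u}. (?\<alpha> x + real (count_list t x)) / norm_A G0 m \<delta> v j)"
      by (subst measure_measure_pmf_finite) (auto simp: pmf_urn_kernel[OF urn_init_pos] W intro!: sum.cong)
    also have "\<dots> = ((\<Sum>x\<in>{x \<in> {1..?s}. ?\<gamma> x = u}. ?\<alpha> x)
        + real (\<Sum>x\<in>{x \<in> {1..?s}. ?\<gamma> x = u}. count_list t x)) / norm_A G0 m \<delta> v j"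
      by (simp add: sum_divide_distrib[symmetric] sum.distrib)
    also have "(\<Sum>x\<in>{x \<in> {1..?s}. ?\<gamma> x = u}. count_list t x) = count_list (map ?\<gamma> t) u"
      by (rule sum_count_list_group) (use urn_targets_set[OF t(1)] in auto)
    finally show ?thesis .
  qed
  have deg: "mg_degree (urn_graph G0 ?\<gamma> t) u =
      mg_degree G0 u + card {x \<in> {3..?s - 1}. ?\<gamma> x = u} + count_list (map ?\<gamma> t) u" for u
    by (simp add: mg_degree_urn_graph)
  have range: "1 \<le> u \<and> u \<le> v" if u: "u \<in> ?\<gamma> ` {1..?s}" for u
  proof -
    obtain x where x: "1 \<le> x" "x \<le> ?s" "u = ?\<gamma> x" using u by auto
    then have u': "1 \<le> u" "partial_sum m (u - 1) < x"
      using group_of_eq_iff[OF valid, of x u] by auto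
    have "x \<le> partial_sum m v" using x t(2) v by (cases v) auto
    then have "\<not> v \<le> u - 1" using u'(2) partial_sum_mono[of v "u - 1" m] by linarith
    then show ?thesis using u' by auto
  qed
  \<comment> \<open>The attachment weights are recognised as the mass function of an existing
    \<open>pmf\<close>; this proves at once that \<open>embed_pmf\<close> is meaningful for
    them.\<close>
  have "(\<lambda>u. if 1 \<le> u \<and> u < v then (real (mg_degree (urn_graph G0 ?\<gamma> t) u) + \<delta>) / norm_A G0 m \<delta> v j
      else if u = v then (real (mg_degree (urn_graph G0 ?\<gamma> t) v) + 1 + real j / real (m v) * \<delta>) / norm_A G0 m \<delta> v j
      else 0) = pmf (map_pmf ?\<gamma> ?K)"
  proof
    fix u
    show "(if 1 \<le> u \<and> u < v then (real (mg_degree (urn_graph G0 ?\<gamma> t) u) + \<delta>) / norm_A G0 m \<delta> v j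
      else if u = v then (real (mg_degree (urn_graph G0 ?\<gamma> t) v) + 1 + real j / real (m v) * \<delta>) / norm_A G0 m \<delta> v j
      else 0) = pmf (map_pmf ?\<gamma> ?K) u"
    proof (cases "1 \<le> u \<and> u \<le> v")
      case True
      then show ?thesis
        unfolding pmf deg using sum_group_urn_init[OF v t(2), of u] v by auto
    next
      case False
      then have none: "{x \<in> {1..?s}. ?\<gamma> x = u} = {}" using range by blast
      have "u \<notin> set (map ?\<gamma> t)"
      proof
        assume "u \<in> set (map ?\<gamma> t)"
        then have "u \<in> ?\<gamma> ` {1..?s}" using urn_targets_set[OF t(1)] by fastforce
        then show False using False range by blast
      qed
      then have "count_list (map ?\<gamma> t) u = 0" by (rule iffD2[OF count_list_0_iff])
      with none have "pmf (map_pmf ?\<gamma> ?K) u = 0" unfolding pmf by (simp only:) simp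
      then show ?thesis using False v by auto
    qed
  qed
  then show ?thesis
    unfolding attach_pmf_def by (simp only:) (rule type_definition.Rep_inverse[OF td_pmf_embed_pmf, symmetric])
qed

text \<open>Since the transition factors through the graph, the image of the urn chain is again a
  Markov chain, with the kernel of model (A). The j-th edge of v is the edge of the j-th urn vertex
  in its group.\<close>

lemma bind_attach_edges_urn:
  assumes v: "3 \<le> v" "j \<le> m v"
  shows "bind_pmf (map_pmf (urn_graph G0 (group_of m)) (urn_pmf (urn_init G0 m \<delta>) (partial_sum m (v - 1) - 2)))
      (attach_edges G0 m \<delta> v j) =
    map_pmf (urn_graph G0 (group_of m)) (urn_pmf (urn_init G0 m \<delta>) (partial_sum m (v - 1) + j - 2))"
  using v(2)
proof (induction j)
  case 0
  have "attach_edges G0 m \<delta> v 0 = return_pmf" by (rule ext) simp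
  then show ?case by (simp only: bind_return_pmf') simp
next
  case (Suc j)
  let ?Q = "urn_pmf (urn_init G0 m \<delta>)" and ?g = "urn_graph G0 (group_of m)"
  let ?s = "partial_sum m (v - 1)"
  have s2: "2 \<le> ?s"
    using partial_sum_mono[of 2 "v - 1" m] partial_sum_2[OF valid] v by auto
  have "bind_pmf (map_pmf ?g (?Q (?s - 2))) (attach_edges G0 m \<delta> v (Suc j)) =
      bind_pmf (bind_pmf (map_pmf ?g (?Q (?s - 2))) (attach_edges G0 m \<delta> v j))
        (\<lambda>g. map_pmf (\<lambda>u. add_mset (Upair v u) g) (attach_pmf G0 m \<delta> v (Suc j) g))"
  proof -
    have "attach_edges G0 m \<delta> v (Suc j) = (\<lambda>g. bind_pmf (attach_edges G0 m \<delta> v j g)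
        (\<lambda>g. map_pmf (\<lambda>u. add_mset (Upair v u) g) (attach_pmf G0 m \<delta> v (Suc j) g)))"
      by (rule ext) simp
    then show ?thesis by (simp only: bind_assoc_pmf)
  qed
  also have "\<dots> = bind_pmf (?Q (?s + j - 2))
      (\<lambda>t. map_pmf (\<lambda>u. add_mset (Upair v u) (?g t)) (attach_pmf G0 m \<delta> v (Suc j) (?g t)))"
    using Suc by (simp add: bind_map_pmf)
  also have "\<dots> = bind_pmf (?Q (?s + j - 2)) (\<lambda>t. map_pmf (\<lambda>u. ?g (t @ [u])) (urn_kernel (urn_init G0 m \<delta>) t))"
  proof (rule bind_pmf_cong[OF refl])
    fix t assume "t \<in> set_pmf (?Q (?s + j - 2))"
    then have t: "length t = ?s + j - 2" "urn_targets t" using set_urn_pmf[OF urn_init_pos] by auto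
    then have len: "length t + 3 = ?s + Suc j" using s2 by simp
    have "group_of m (length t + 3) = v"
      by (rule group_of_eqI) (use v Suc.prems len in \<open>cases v; auto\<close>)+
    then show "map_pmf (\<lambda>u. add_mset (Upair v u) (?g t)) (attach_pmf G0 m \<delta> v (Suc j) (?g t)) =
        map_pmf (\<lambda>u. ?g (t @ [u])) (urn_kernel (urn_init G0 m \<delta>) t)"
      using map_urn_kernel[OF t(2) len v(1) _ Suc.prems]
      by (simp add: urn_graph_snoc pmf.map_comp o_def flip: map_urn_kernel[OF t(2) len v(1) _ Suc.prems])
  qed
  also have "\<dots> = map_pmf ?g (?Q (Suc (?s + j - 2)))"
    by (simp add: map_bind_pmf pmf.map_comp o_def)
  also have "Suc (?s + j - 2) = ?s + Suc j - 2" using s2 by simp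
  finally show ?case .
qed

lemma PA_A_law_eq_urn:
  assumes "2 \<le> n"
  shows "PA_A_law G0 m \<delta> n =
    map_pmf (urn_graph G0 (group_of m)) (urn_pmf (urn_init G0 m \<delta>) (partial_sum m n - 2))"
  using assms
proof (induction n rule: dec_induct)
  case base
  then show ?case using partial_sum_2[OF valid] by (simp add: numeral_2_eq_2)
next
  case (step n)
  then show ?case
    using bind_attach_edges_urn[of "Suc n" "m (Suc n)"] by simp
qed

end

end

section \<open>Conditioning on the out-degrees\<close>

text \<open>With s = m_[k-1] + l, the l - 1 earlier members of the group and the s - 3 earlier edges
  give the weight below s; each of the two counts contributes m_[k-1] + l - 3, whence the factor
  2.\<close>

lemma psi_law_eq_urn_psi:
  assumes valid: "valid_degrees m \<delta>" and s: "1 \<le> s"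
    and a_delta: "\<forall>i\<in>{1, 2}. real (mg_degree G0 i) + \<delta> > 0"
  shows "psi_law G0 m \<delta> s = urn_psi (urn_init G0 m \<delta>) s"
proof -
  consider "s = 1" | "s = 2" | "3 \<le> s" using s by linarith
  then show ?thesis
  proof cases
    case 1
    then show ?thesis by (simp add: psi_law_def urn_psi_def)
  next
    case 2
    have "{1..<2 :: nat} = {1}" by auto
    then show ?thesis using 2 by (simp add: psi_law_def urn_psi_def urn_beta_def urn_init_def)
  next
    case 3
    define k where "k = group_of m s"
    have k: "1 \<le> k" "partial_sum m (k - 1) < s" "s \<le> partial_sum m k"
      using group_of_eq_iff[OF valid s, of k] by (auto simp: k_def)
    have "3 \<le> k"
    proof (rule ccontr)
      assume "\<not> 3 \<le> k"
      then have "partial_sum m k \<le> partial_sum m 2" by (intro partial_sum_mono) auto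
      then show False using 3 k partial_sum_2[OF valid] by auto
    qed
    define l where "l = s - partial_sum m (k - 1)"
    have sl: "s = partial_sum m (k - 1) + l" "1 \<le> l" "l \<le> m k"
      using k by (cases k; auto simp: l_def)+
    have "{1..<s} = {1..partial_sum m (k - 1) + (l - 1)}" using sl by auto
    then have "urn_beta (urn_init G0 m \<delta>) s =
        (\<Sum>j\<in>{1..partial_sum m (k - 1) + (l - 1)}. urn_init G0 m \<delta> j) + real (s - 3)"
      by (simp add: urn_beta_def)
    also have "\<dots> = real (mg_degree G0 1) + real (mg_degree G0 2) + 2 * (real (partial_sum m (k - 1)) + real l - 3)
        + (real k - 1) * \<delta> + (real l - 1) / real (m k) * \<delta>"
      using sum_urn_init_upto[OF valid a_delta \<open>3 \<le> k\<close>, of "l - 1"] sl 3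
      by (simp add: of_nat_diff)
    finally have "urn_beta (urn_init G0 m \<delta>) s = \<dots>" .
    moreover have "urn_init G0 m \<delta> s = 1 + \<delta> / real (m k)"
      using 3 by (simp add: urn_init_def k_def)
    ultimately show ?thesis
      using 3 by (simp add: psi_law_def urn_psi_def Let_def k_def l_def)
  qed
qed

lemma psi_U_law_eq_urn_law:
  assumes "valid_degrees m \<delta>" "\<forall>i\<in>{1, 2}. real (mg_degree G0 i) + \<delta> > 0"
  shows "psi_U_law G0 m \<delta> = urn_law (urn_init G0 m \<delta>)"
proof -
  have "(\<Pi>\<^sub>M s\<in>{1..}. psi_law G0 m \<delta> s) = (\<Pi>\<^sub>M s\<in>{1..}. urn_psi (urn_init G0 m \<delta>) s)"
    by (intro PiM_cong refl psi_law_eq_urn_psi assms) auto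
  then show ?thesis by (simp add: psi_U_law_def urn_law_def)
qed

text \<open>An identity for every m, exceptional realisations included; therefore \<open>G0\<close>
  appears collapsed here, and is recognised as unchanged only for valid degrees.\<close>

lemma CPU_SL_eq_urn_graph:
  "CPU_SL G0 n m \<psi> U = urn_graph (image_mset (map_uprod (group_of m)) G0) (group_of m)
     (targets (partial_sum m n) \<psi> U)"
proof -
  let ?N = "partial_sum m n"
  have "mset_set {3..?N} = image_mset (\<lambda>r. r + 3) (mset_set {0..<?N - 2})"
  proof (subst image_mset_mset_set)
    show "inj_on (\<lambda>r. r + 3) {0..<?N - 2}" by simp
    have "(\<lambda>r. r + 3) ` {0..<?N - 2} = {3..?N}"
    proof (intro equalityI subsetI)
      fix x assume "x \<in> {3..?N}"
      then show "x \<in> (\<lambda>r. r + 3) ` {0..<?N - 2}" by (intro image_eqI[of _ _ "x - 3"]) auto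
    qed auto
    then show "mset_set {3..?N} = mset_set ((\<lambda>r. r + 3) ` {0..<?N - 2})" by simp
  qed
  then show ?thesis
    by (auto simp: CPU_SL_def PU_SL_def urn_graph_def targets_def target_def multiset.map_comp o_def
        intro!: image_mset_cong)
qed

lemma targets_restrict:
  "targets N (restrict \<psi> {1..}) (restrict U {1..}) = targets N \<psi> U"
proof -
  have "S_pos N (restrict \<psi> {1..}) s = S_pos N \<psi> s" for s
    by (auto simp: S_pos_def intro!: prod.cong)
  then show ?thesis by (simp add: targets_def target_def I_int_def)
qed

lemma length_targets [simp]: "length (targets N \<psi> U) = N - 2"
  by (simp add: targets_def)

text \<open>
  \<open>targets\<close> may contain junk values of \<open>THE\<close>, but they are values of \<open>THE\<close> on subsets of a fixed
  finite set.
\<close>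

lemma targets_bounded: "\<exists>B. \<forall>\<psi> U. \<forall>u\<in>set (targets N \<psi> U). u \<le> B"
proof -
  have "finite (\<Union>r<N - 2. (\<lambda>A. THE u. u \<in> A) ` Pow {1..r + 3})"
    by auto
  then obtain B :: nat where B: "\<And>u. u \<in> (\<Union>r<N - 2. (\<lambda>A. THE u. u \<in> A) ` Pow {1..r + 3}) \<Longrightarrow> u \<le> B"
    unfolding finite_nat_set_iff_bounded_le by blast
  have "u \<le> B" if "u \<in> set (targets N \<psi> U)" for \<psi> U u
  proof -
    obtain r where r: "r < N - 2" "u = target N \<psi> U (r + 3)"
      using \<open>u \<in> set (targets N \<psi> U)\<close> by (auto simp: targets_def)
    let ?A = "{u \<in> {1..r + 3}. U (r + 3) * S_pos N \<psi> (r + 3) \<in> I_int N \<psi> u}"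
    have "u = (THE u. u \<in> ?A)" unfolding r(2) target_def by simp
    moreover have "?A \<in> Pow {1..r + 3}" by auto
    ultimately show ?thesis using r(1) by (intro B) blast
  qed
  then show ?thesis by blast
qed

section \<open>Freezing the degrees inside conditional probabilities\<close>

lemma urn_graph_cong:
  assumes "\<And>s. s \<in> {3..length t + 2} \<union> set t \<Longrightarrow> \<gamma> s = \<gamma>' s"
  shows "urn_graph G \<gamma> t = urn_graph G \<gamma>' t"
  unfolding urn_graph_def
  by (intro arg_cong[where f = "\<lambda>x. G + mset x"] map_cong refl) (use assms in auto)

lemma image_mset_map_uprod_cong:
  assumes "mgraph_on n G" "\<And>u. u \<in> {1..n} \<Longrightarrow> f u = g u"
  shows "image_mset (map_uprod f) G = image_mset (map_uprod g) G"
proof (intro image_mset_cong uprod.map_cong refl)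
  fix e u assume "e \<in># G" "u \<in> set_uprod e"
  then show "f u = g u" using assms(1) unfolding mgraph_on_def by (intro assms(2)) blast
qed

lemma countable_mgraph_on: "countable {G. mgraph_on n G}"
proof -
  have "{G. mgraph_on n G} \<subseteq> mset ` lists (range (\<lambda>(a, b). Upair a b))"
  proof
    fix G :: mgraph
    obtain xs where xs: "G = mset xs" using ex_mset by metis
    have "e \<in> range (\<lambda>(a, b). Upair a b)" for e :: "nat uprod"
      by (cases e) auto
    then show "G \<in> mset ` lists (range (\<lambda>(a, b). Upair a b))" using xs by blast
  qed
  then show ?thesis
    by (rule countable_subset) (intro countable_image countable_lists countableI_type)
qed

text \<open>On the cell where Z = z the events E and E' z coincide. The cell belongs to F, so its
  indicator can be pulled out of the conditional expectation. Countably many cells cost one null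
  set.\<close>

lemma cprob_eq_on_countable_partition:
  fixes Z :: "'w \<Rightarrow> 'z :: countable"
  assumes "prob_space P" and sub: "subalgebra P F" and Z: "Z \<in> F \<rightarrow>\<^sub>M count_space UNIV"
    and E': "\<And>z. E' z \<in> sets P" and E: "E \<subseteq> space P" "\<And>w. w \<in> space P \<Longrightarrow> w \<in> E \<longleftrightarrow> w \<in> E' (Z w)"
  shows "AE w in P. cprob P F E w = cprob P F (E' (Z w)) w"
proof -
  interpret prob_space P by fact
  interpret finite_measure_subalgebra P F by unfold_locales (rule sub)
  have Zset: "Z -` {z} \<inter> space P \<in> sets F" for z
    using measurable_sets[OF Z, of "{z}"] sub by (simp add: subalgebra_def)
  have ZP: "Z -` {z} \<inter> space P \<in> sets P" for z
    using Zset sub unfolding subalgebra_def by blast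
  have "E = (\<Union>z. E' z \<inter> (Z -` {z} \<inter> space P))"
    using E by auto
  also have "\<dots> \<in> sets P"
    by (intro sets.countable_UN image_subsetI sets.Int E' ZP)
  finally have EP: "E \<in> sets P" .
  have "AE w in P. \<forall>z. indicator (Z -` {z} \<inter> space P) w * cprob P F E w =
      indicator (Z -` {z} \<inter> space P) w * cprob P F (E' z) w"
  proof (subst AE_all_countable, intro allI)
    fix z
    let ?D = "Z -` {z} \<inter> space P"
    note D = Zset[of z] ZP[of z]
    have *: "AE w in P. real_cond_exp P F (\<lambda>x. indicator ?D x * indicator A x) w =
        indicator ?D w * real_cond_exp P F (indicator A) w" if "A \<in> sets P" for A
      using D that by (intro real_cond_exp_mult) (auto simp: less_top[symmetric] simp flip: indicator_inter_arith intro!: integrable_real_indicator)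
    have eq: "(\<lambda>x. indicator ?D x * indicator E x) = (\<lambda>x. indicator ?D x * indicator (E' z) x :: real)"
      using E by (auto simp: fun_eq_iff indicator_def)
    show "AE w in P. indicator ?D w * cprob P F E w = indicator ?D w * cprob P F (E' z) w"
      using *[OF EP] *[OF E', of z] unfolding eq cprob_def by eventually_elim metis
  qed
  then show ?thesis
    using AE_space
  proof eventually_elim
    case (elim w)
    then show ?case using spec[OF elim(1), of "Z w"] by simp
  qed
qed

lemma measurable_group_of:
  assumes m: "\<And>i. 1 \<le> i \<Longrightarrow> (\<lambda>w. m w i) \<in> F \<rightarrow>\<^sub>M count_space UNIV"
  shows "(\<lambda>w. partial_sum (m w) k) \<in> F \<rightarrow>\<^sub>M count_space UNIV" (is ?A)
    and "(\<lambda>w. group_of (m w) s) \<in> F \<rightarrow>\<^sub>M count_space UNIV"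
proof -
  have ps [measurable]: "(\<lambda>w. partial_sum (m w) k) \<in> F \<rightarrow>\<^sub>M count_space UNIV" for k
  proof (induction k)
    case (Suc k)
    have [measurable]: "(\<lambda>w. m w (Suc k)) \<in> F \<rightarrow>\<^sub>M count_space UNIV" by (rule m) simp
    note Suc.IH [measurable]
    show ?case unfolding partial_sum_Suc by measurable
  qed simp
  then show ?A .
  show "(\<lambda>w. group_of (m w) s) \<in> F \<rightarrow>\<^sub>M count_space UNIV"
    unfolding group_of_def
  proof (rule measurable_THE[where I = UNIV])
    show "Measurable.pred F (\<lambda>w. 1 \<le> k \<and> s \<in> {partial_sum (m w) (k - 1) + 1..partial_sum (m w) k})" for k
      unfolding atLeastAtMost_iff by measurable
    fix w k l
    assume "1 \<le> k \<and> s \<in> {partial_sum (m w) (k - 1) + 1..partial_sum (m w) k}"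
      "1 \<le> l \<and> s \<in> {partial_sum (m w) (l - 1) + 1..partial_sum (m w) l}"
    then show "k = l" using group_of_eqI[of k "m w" s] group_of_eqI[of l "m w" s] by auto
  qed auto
qed

text \<open>The claim for a deterministic degree sequence: both laws are images of
  \<open>urn_pmf\<close> under the same map \<open>?g\<close>.\<close>

lemma measure_urn_law_graph:
  assumes valid: "valid_degrees m \<delta>" and a_delta: "\<forall>i\<in>{1, 2}. real (mg_degree G0 i) + \<delta> > 0"
    and G0: "mgraph_on 2 G0" and n: "2 \<le> n"
  shows "measure (psi_U_law G0 m \<delta>)
      {x \<in> space (psi_U_law G0 m \<delta>). urn_graph G0 (group_of m) (targets (partial_sum m n) (fst x) (snd x)) = G}
    = measure (measure_pmf (PA_A_law G0 m \<delta> n)) {G}"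
proof -
  let ?N = "partial_sum m n" and ?\<alpha> = "urn_init G0 m \<delta>"
  let ?g = "urn_graph G0 (group_of m)"
  have \<alpha>: "\<forall>s\<ge>1. ?\<alpha> s > 0" by (rule urn_init_pos[OF valid a_delta])
  have N: "2 \<le> ?N" using le_partial_sum[OF valid, of n] n by simp
  have meas: "(\<lambda>x. targets ?N (fst x) (snd x)) \<in> urn_law ?\<alpha> \<rightarrow>\<^sub>M count_space UNIV"
    using measurable_targets[of ?N] measurable_cong_sets[OF sets_urn_law refl] by blast
  have "measure (psi_U_law G0 m \<delta>) {x \<in> space (psi_U_law G0 m \<delta>). ?g (targets ?N (fst x) (snd x)) = G} =
      measure (distr (urn_law ?\<alpha>) (count_space UNIV) (\<lambda>x. targets ?N (fst x) (snd x))) {t. ?g t = G}"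
    unfolding psi_U_law_eq_urn_law[OF valid a_delta]
    by (subst measure_distr[OF meas]) (auto simp: vimage_def Int_def conj_commute)
  also have "\<dots> = measure (measure_pmf (urn_pmf ?\<alpha> (?N - 2))) {t. ?g t = G}"
    by (simp only: distr_urn_law_targets[OF \<alpha> N])
  also have "\<dots> = pmf (PA_A_law G0 m \<delta> n) G"
    by (simp add: PA_A_law_eq_urn[OF valid a_delta G0 n] pmf_map vimage_def)
  finally show ?thesis by (simp add: measure_pmf_single)
qed

theorem mainTheorem2:
  fixes P :: "'w measure"
    and M :: "nat pmf"
    and m :: "'w \<Rightarrow> nat \<Rightarrow> nat"
    and p \<delta> :: real
    and G0 :: mgraph
    and n :: nat
    and PA :: "'w \<Rightarrow> mgraph"
    and \<psi> U :: "'w \<Rightarrow> nat \<Rightarrow> real"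
  assumes prob: "prob_space P"
    and M_pos: "0 \<notin> set_pmf M"
    and p: "p > 1"
    and M_moment: "integrable (measure_pmf M) (\<lambda>k. real k powr p)"
    and delta: "\<delta> > - real (Inf (set_pmf M))"
    and m_init: "\<forall>w\<in>space P. m w 1 = 1 \<and> m w 2 = 1"
    and m_indep: "prob_space.indep_vars P (\<lambda>_. count_space UNIV) (\<lambda>i w. m w i) {3..}"
    and m_law: "\<forall>i\<ge>3. distr P (count_space UNIV) (\<lambda>w. m w i) = measure_pmf M"
    and G0: "mgraph_on 2 G0"
    and a_delta: "\<forall>i\<in>{1, 2}. real (mg_degree G0 i) + \<delta> > 0"
    and n: "n \<ge> 2"
    and PA_law: "has_cond_law P (sigma_m P m) (count_space UNIV) PA
                   (\<lambda>w. measure_pmf (PA_A_law G0 (m w) \<delta> n))"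
    and psi_U: "has_cond_law P (sigma_m P m)
                   ((\<Pi>\<^sub>M s\<in>{1..}. borel) \<Otimes>\<^sub>M (\<Pi>\<^sub>M s\<in>{1..}. borel))
                   (\<lambda>w. (restrict (\<psi> w) {1..}, restrict (U w) {1..}))
                   (\<lambda>w. psi_U_law G0 (m w) \<delta>)"
  shows "AE w in P. \<forall>G. mgraph_on n G \<longrightarrow>
           cprob P (sigma_m P m) {w' \<in> space P. PA w' = G} w =
           cprob P (sigma_m P m) {w' \<in> space P. CPU_SL G0 n (m w') (\<psi> w') (U w') = G} w"
proof -
  interpret prob_space P by fact
  let ?F = "sigma_m P m"
  let ?B = "(\<Pi>\<^sub>M s\<in>{1..}. borel :: real measure) \<Otimes>\<^sub>M (\<Pi>\<^sub>M s\<in>{1..}. borel :: real measure)"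
  let ?X = "\<lambda>w. (restrict (\<psi> w) {1..}, restrict (U w) {1..})"
  have m_meas: "(\<lambda>w. m w i) \<in> P \<rightarrow>\<^sub>M count_space UNIV" if i: "1 \<le> i" for i
  proof -
    consider "i = 1" | "i = 2" | "3 \<le> i" using i by linarith
    then show ?thesis
    proof cases
      case 3
      then show ?thesis using m_indep by (simp add: indep_vars_def)
    qed (use m_init in \<open>simp_all cong: measurable_cong\<close>)
  qed
  have m_restrict: "(\<lambda>w. restrict (m w) {1..}) \<in> P \<rightarrow>\<^sub>M (\<Pi>\<^sub>M i\<in>{1..}. count_space UNIV)"
    by (rule measurable_restrict) (use m_meas in auto)
  have sub: "subalgebra P ?F"
    unfolding subalgebra_def sigma_m_def using sets_image_in_sets[OF refl m_restrict] by (metis space_vimage_algebra)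
  have m_F: "(\<lambda>w. m w i) \<in> ?F \<rightarrow>\<^sub>M count_space UNIV" if "1 \<le> i" for i
  proof -
    have "(\<lambda>w. restrict (m w) {1..}) \<in> ?F \<rightarrow>\<^sub>M (\<Pi>\<^sub>M i\<in>{1..}. count_space UNIV)"
      unfolding sigma_m_def by (rule measurable_vimage_algebra1) (use measurable_space[OF m_restrict] in auto)
    from measurable_compose[OF this measurable_component_singleton[of i]] that show ?thesis by simp
  qed
  have valid: "AE w in P. valid_degrees (m w) \<delta>"
  proof -
    have "AE w in P. \<forall>i. 3 \<le> i \<longrightarrow> m w i \<in> set_pmf M"
    proof (subst AE_all_countable, intro allI)
      fix i
      show "AE w in P. 3 \<le> i \<longrightarrow> m w i \<in> set_pmf M"
      proof (cases "3 \<le> i")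
        case True
        then have law: "distr P (count_space UNIV) (\<lambda>w. m w i) = measure_pmf M" using m_law by blast
        have "AE k in distr P (count_space UNIV) (\<lambda>w. m w i). k \<in> set_pmf M"
          unfolding law by (rule AE_measure_pmf)
        then have "AE w in P. m w i \<in> set_pmf M"
          by (rule AE_distrD[rotated]) (use m_meas True in auto)
        then show ?thesis by eventually_elim simp
      qed simp
    qed
    then show ?thesis
      using AE_space
    proof eventually_elim
      case (elim w)
      \<comment> \<open>A realised degree lies in the support of M, hence is at least its infimum,
        which exceeds -\<delta>.\<close>
      have "1 \<le> m w i \<and> 0 < real (m w i) + \<delta>" if "3 \<le> i" for i
      proof -
        have "m w i \<in> set_pmf M" using elim that by blast
        moreover from this have "Inf (set_pmf M) \<le> m w i" by (intro cInf_lower) auto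
        ultimately show ?thesis using M_pos delta by (cases "m w i") auto
      qed
      then show ?case using m_init elim(2) by (auto simp: valid_degrees_def)
    qed
  qed
  obtain B where B: "\<And>N \<psi> U u. u \<in> set (targets N \<psi> U) \<Longrightarrow> u \<le> B N"
    using targets_bounded by metis
  \<comment> \<open>\<open>Z w\<close> is a countably valued function of \<open>m w\<close> that determines how \<open>CPU_SL\<close> depends on \<open>(\<psi>, U)\<close>.
    The list is long enough to contain the groups of all targets, junk values included.\<close>
  define b where "b N = Suc (max (B N) (N + 2))" for N
  define Z where "Z w = (partial_sum (m w) n, map (group_of (m w)) [0..<b (partial_sum (m w) n)])" for w
  have Z: "Z \<in> ?F \<rightarrow>\<^sub>M count_space UNIV"
  proof -
    \<comment> \<open>The length of the list in Z varies with w. It is fixed as \<open>b N\<close>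
      first, and N is then replaced by its random value, which ranges over a countable set.\<close>
    have "(\<lambda>w. map (\<lambda>s. group_of (m w) s) [0..<b N]) \<in> ?F \<rightarrow>\<^sub>M count_space UNIV" for N
      by (intro measurable_map_list measurable_group_of m_F)
    then have pair: "(\<lambda>w. (N, map (group_of (m w)) [0..<b N])) \<in> ?F \<rightarrow>\<^sub>M count_space UNIV" for N
      by (rule measurable_compose) (rule measurable_count_space)
    have "(\<lambda>w. partial_sum (m w) n) \<in> ?F \<rightarrow>\<^sub>M count_space UNIV"
      by (intro measurable_group_of m_F)
    from measurable_compose_countable[OF pair this]
    show ?thesis by (simp add: Z_def[abs_def])
  qed
  \<comment> \<open>The collapse map and the number of urn vertices become arguments, so that they
    can be frozen at a value of Z.\<close>
  define g where "g \<gamma> N x = urn_graph (image_mset (map_uprod \<gamma>) G0) \<gamma> (targets N (fst x) (snd x))"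
    for \<gamma> :: "nat \<Rightarrow> nat" and N and x :: "(nat \<Rightarrow> real) \<times> (nat \<Rightarrow> real)"
  have g_Z: "g (group_of (m w)) (partial_sum (m w) n) x = g ((!) (snd (Z w))) (fst (Z w)) x" for w x
  proof -
    let ?N = "partial_sum (m w) n"
    have nth: "snd (Z w) ! s = group_of (m w) s" if "s < b ?N" for s
      using that by (simp add: Z_def)
    have "image_mset (map_uprod (group_of (m w))) G0 = image_mset (map_uprod ((!) (snd (Z w)))) G0"
    proof (rule image_mset_map_uprod_cong[OF G0])
      fix u :: nat assume "u \<in> {1..2}"
      then have "u < b ?N" by (auto simp: b_def)
      then show "group_of (m w) u = snd (Z w) ! u" by (simp add: nth)
    qed
    moreover have "urn_graph G (group_of (m w)) (targets ?N (fst x) (snd x)) =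
        urn_graph G ((!) (snd (Z w))) (targets ?N (fst x) (snd x))" for G
    proof (rule urn_graph_cong)
      fix s assume "s \<in> {3..length (targets ?N (fst x) (snd x)) + 2} \<union> set (targets ?N (fst x) (snd x))"
      then have "s < b ?N" using B[of s ?N "fst x" "snd x"] by (auto simp: b_def)
      then show "group_of (m w) s = snd (Z w) ! s" by (simp add: nth)
    qed
    ultimately show ?thesis by (simp add: g_def Z_def)
  qed
  have "AE w in P. cprob P ?F {w' \<in> space P. PA w' = G} w =
      cprob P ?F {w' \<in> space P. CPU_SL G0 n (m w') (\<psi> w') (U w') = G} w" for G
  proof -
    define A where "A z = {x \<in> space ?B. g ((!) (snd z)) (fst z) x = G}" for z :: "nat \<times> nat list"
    have A: "A z \<in> sets ?B" for z
    proof -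
      have "(\<lambda>x. targets (fst z) (fst x) (snd x)) -` {t. urn_graph (image_mset (map_uprod ((!) (snd z))) G0) ((!) (snd z)) t = G}
          \<inter> space ?B \<in> sets ?B"
        by (rule measurable_sets[OF measurable_targets]) simp
      then show ?thesis by (simp add: A_def g_def vimage_def Int_def conj_commute)
    qed
    have X: "?X \<in> P \<rightarrow>\<^sub>M ?B"
      using psi_U by (simp add: has_cond_law_def)
    \<comment> \<open>The null set must not depend on z, because z is set to Z w afterwards.\<close>
    have law: "AE w in P. \<forall>z. cprob P ?F {w' \<in> space P. ?X w' \<in> A z} w = measure (psi_U_law G0 (m w) \<delta>) (A z)"
      using psi_U A unfolding has_cond_law_def by (subst AE_all_countable) auto
    have part: "AE w in P. cprob P ?F {w' \<in> space P. CPU_SL G0 n (m w') (\<psi> w') (U w') = G} w =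
        cprob P ?F {w' \<in> space P. ?X w' \<in> A (Z w)} w"
    proof (rule cprob_eq_on_countable_partition[OF prob sub Z])
      show "{w' \<in> space P. ?X w' \<in> A z} \<in> sets P" for z
        using measurable_sets[OF X A, of z] by (simp add: vimage_def Int_def conj_commute)
      fix w assume w: "w \<in> space P"
      have "g (group_of (m w)) (partial_sum (m w) n) (?X w) = CPU_SL G0 n (m w) (\<psi> w) (U w)"
        by (simp only: g_def fst_conv snd_conv targets_restrict CPU_SL_eq_urn_graph)
      then show "w \<in> {w' \<in> space P. CPU_SL G0 n (m w') (\<psi> w') (U w') = G} \<longleftrightarrow>
          w \<in> {w' \<in> space P. ?X w' \<in> A (Z w)}"
        using w measurable_space[OF X w] g_Z[of w "?X w"] by (simp add: A_def)
    qed auto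
    have PA: "AE w in P. cprob P ?F {w' \<in> space P. PA w' = G} w =
        measure (measure_pmf (PA_A_law G0 (m w) \<delta> n)) {G}"
    proof -
      have "{G} \<in> sets (count_space UNIV)" by simp
      from bspec[OF conjunct2[OF PA_law[unfolded has_cond_law_def]] this] show ?thesis
        by (simp only: singleton_iff)
    qed
    show ?thesis
      using PA part law valid
    proof eventually_elim
      case (elim w)
      \<comment> \<open>Since m_1 = m_2 = 1, the collapse fixes the vertices 1 and 2.\<close>
      have G0_eq: "image_mset (map_uprod (group_of (m w))) G0 = G0"
      proof -
        have "group_of (m w) u = id u" if "u \<in> {1..2}" for u
          using that group_of_1[OF elim(4)] group_of_2[OF elim(4)] by (auto simp: le_Suc_eq numeral_2_eq_2)
        then have "image_mset (map_uprod (group_of (m w))) G0 = image_mset (map_uprod id) G0"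
          using G0 by (intro image_mset_map_uprod_cong)
        then show ?thesis by (simp add: uprod.map_id0)
      qed
      have "space (psi_U_law G0 (m w) \<delta>) = space ?B"
        unfolding psi_U_law_eq_urn_law[OF elim(4) a_delta] by (rule sets_eq_imp_space_eq[OF sets_urn_law])
      then have "A (Z w) = {x \<in> space (psi_U_law G0 (m w) \<delta>).
          urn_graph G0 (group_of (m w)) (targets (partial_sum (m w) n) (fst x) (snd x)) = G}"
        unfolding A_def g_Z[symmetric] by (simp add: g_def G0_eq)
      then have "measure (psi_U_law G0 (m w) \<delta>) (A (Z w)) = measure (measure_pmf (PA_A_law G0 (m w) \<delta> n)) {G}"
        using measure_urn_law_graph[OF elim(4) a_delta G0 n, of G] by (simp only:)
      with elim(1,2) spec[OF elim(3), of "Z w"] show ?case by (simp only:)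
    qed
  qed
  \<comment> \<open>Countability of the set of graphs yields one null set for all G.\<close>
  then have "AE w in P. \<forall>G\<in>{G. mgraph_on n G}. cprob P ?F {w' \<in> space P. PA w' = G} w =
      cprob P ?F {w' \<in> space P. CPU_SL G0 n (m w') (\<psi> w') (U w') = G} w"
    by (subst AE_ball_countable[OF countable_mgraph_on]) blast
  then show ?thesis by simp
qed

end
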